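(* Let $(X,\Sigma,\mu)$ be a Dedekind measure space, let $\nu$ be a positive measure on $(X,\Sigma)$ with $\nu\ll\mu$, and let $(S,\mu_{|S})$ be the semifinite part of $\mu$. Assume that either (i) $\nu$ is $\mu$-semifinite; or (ii) $\nu$ is $\mu_{|S}$-semifinite on $S$, and $\nu=\infty$ on all nonempty measurable subsets of $S^c$. Then there exists a measurable $h:X\to[0,\infty]$ with $\nu(E)=\int_E h\,d\mu$ for all $E\in\Sigma$. Such $h$ is necessarily $\mu$-a.e. unique on $S$. Also, $\psi_\nu$ is normal on $L^\infty(X,\Sigma,\mu)_+$. Finally, if $(X,\Sigma,\mu)$ is Dedekind, $\nu\ll\mu$, and either (i) or (ii) holds, then, with $h:X\to[0,\infty]$ denoting a measurable function satisfying $\nu(E)=\int_E h\,d\mu$ for all $E\in\Sigma$: (1) $\mu\ll\nu$ if and only if $h$ may be chosen to be strictly positive; (2) $\nu$ is semifinite on $S$ if and only if $h$ may be chosen to be finite on $S$.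
   Context: All measures are positive. $L^\infty(X,\Sigma,\mu)$ is the commutative $C^*$-algebra of essentially bounded complex measurable functions modulo $\mu$-a.e. equality; its projections are the classes $[\chi_E]$, $E\in\Sigma$, and they form a lattice. A measure is semifinite if every set of infinite measure contains a measurable subset of strictly positive finite measure. $(X,\Sigma,\mu)$ is Dedekind if every increasing net of projections of $L^\infty(X,\Sigma,\mu)$ has a supremum in the lattice of projections. If $(X,\Sigma,\mu)$ is Dedekind, there is a set $S\in\Sigma$, unique up to $\mu$-null sets, such that $(S,\mu_{|S})$ is semifinite and $\mu(E)=\infty$ for every measurable $E\subset X\setminus S$ with $\mu(E)>0$; $(S,\mu_{|S})$ is called the semifinite part of $\mu$. $\nu\ll\mu$ means $\nu(E)=0$ whenever $\mu(E)=0$. $\nu$ is $\mu$-semifinite if whenever $\nu(E)>0$ there is a measurable $F\subset E$ with $\mu(F)<\infty$ and $\nu(F)>0$; $\nu$ is $\mu_{|S}$-semifinite on $S$ if this holds for all measurable $E\subset S$. $\psi_\nu(f)=\int_X f\,d\nu$ for $f\in L^\infty(X,\Sigma,\mu)_+$. It is normal if $\psi_\nu(\sup_t f_t)=\sup_t\psi_\nu(f_t)$ whenever $(f_t)$ is an increasing net in $L^\infty(X,\Sigma,\mu)_+$ possessing a supremum in $L^\infty(X,\Sigma,\mu)_+$. *)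

theory Defs
  imports
    "HOL-Analysis.Analysis"
    "HOL-Library.Complex_Order"
    "HOL-Algebra.Order"
begin

section \<open>The ordered space of essentially bounded functions\<close>

definition ess_bounded :: "'a measure \<Rightarrow> ('a \<Rightarrow> complex) set" where
  "ess_bounded M = {f \<in> borel_measurable M. \<exists>C. AE x in M. norm (f x) \<le> C}"

definition ae_equal :: "'a measure \<Rightarrow> ('a \<Rightarrow> complex) rel" where
  "ae_equal M = {(f, g). f \<in> ess_bounded M \<and> g \<in> ess_bounded M \<and> (AE x in M. f x = g x)}"

text \<open>An element of \<open>L\<^sup>\<infinity>\<close> is an equivalence class, that is, a set of functions.\<close>

definition Linfty :: "'a measure \<Rightarrow> ('a \<Rightarrow> complex) set set" where
  "Linfty M = ess_bounded M // ae_equal M"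

text \<open>The comparison of complex numbers below is that of \<^theory>\<open>HOL-Library.Complex_Order\<close>
  (\<open>w - z\<close> is real and nonnegative), so this is the order given by the positive cone of the
  \<open>C\<^sup>*\<close>-algebra. On classes the choice of the representatives is irrelevant.\<close>

definition Linfty_le ::
    "'a measure \<Rightarrow> ('a \<Rightarrow> complex) set \<Rightarrow> ('a \<Rightarrow> complex) set \<Rightarrow> bool" where
  "Linfty_le M F G \<longleftrightarrow> (\<exists>f\<in>F. \<exists>g\<in>G. AE x in M. f x \<le> g x)"

definition Linfty_pos :: "'a measure \<Rightarrow> ('a \<Rightarrow> complex) set gorder" where
  "Linfty_pos M =
     \<lparr>carrier = {F \<in> Linfty M. \<exists>f\<in>F. AE x in M. 0 \<le> f x}, eq = (=), le = Linfty_le M\<rparr>"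

definition projections :: "'a measure \<Rightarrow> ('a \<Rightarrow> complex) set gorder" where
  "projections M =
     \<lparr>carrier = {ae_equal M `` {indicator E} | E. E \<in> sets M}, eq = (=), le = Linfty_le M\<rparr>"

section \<open>Nets\<close>

text \<open>\<open>x\<close> is an increasing net in \<open>L\<close>, indexed by \<open>I\<close> with the upward directed preorder \<open>r\<close>.\<close>

definition increasing_net :: "'b gorder \<Rightarrow> 'i set \<Rightarrow> 'i rel \<Rightarrow> ('i \<Rightarrow> 'b) \<Rightarrow> bool" where
  "increasing_net L I r x \<longleftrightarrow>
     I \<noteq> {} \<and> preorder_on I r \<and> (\<forall>i\<in>I. \<forall>j\<in>I. \<exists>k\<in>I. (i, k) \<in> r \<and> (j, k) \<in> r) \<and>
     x \<in> I \<rightarrow> carrier L \<and> (\<forall>(i, j)\<in>r. x i \<sqsubseteq>\<^bsub>L\<^esub> x j)"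

definition is_net_sup :: "'b gorder \<Rightarrow> 'i set \<Rightarrow> ('i \<Rightarrow> 'b) \<Rightarrow> 'b \<Rightarrow> bool" where
  "is_net_sup L I x s \<longleftrightarrow> least L s (Upper L (x ` I))"

section \<open>Classes of measures\<close>

text \<open>A definition cannot quantify over the type of the index sets. Here it is the type of the
  members of the net, which loses nothing: the range of an increasing net with any index set is
  upward directed and, indexed by itself, is an increasing net with the same suprema.\<close>

definition Dedekind :: "'a measure \<Rightarrow> bool" where
  "Dedekind M \<longleftrightarrow>
     (\<forall>(I :: ('a \<Rightarrow> complex) set set) r x.
        increasing_net (projections M) I r x \<longrightarrow>
        (\<exists>s. is_net_sup (projections M) I x s))"

text \<open>The library locale \<^locale>\<open>semifinite_measure\<close> does not require the subset of finite
  measure to have positive measure (the empty set satisfies it), hence this definition.\<close>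

definition semifinite :: "'a measure \<Rightarrow> bool" where
  "semifinite M \<longleftrightarrow>
     (\<forall>E\<in>sets M. emeasure M E = \<infinity> \<longrightarrow>
        (\<exists>F\<in>sets M. F \<subseteq> E \<and> 0 < emeasure M F \<and> emeasure M F < \<infinity>))"

definition semifinite_part :: "'a measure \<Rightarrow> 'a set \<Rightarrow> bool" where
  "semifinite_part M S \<longleftrightarrow>
     S \<in> sets M \<and> semifinite (restrict_space M S) \<and>
     (\<forall>E\<in>sets M. E \<subseteq> space M - S \<and> 0 < emeasure M E \<longrightarrow> emeasure M E = \<infinity>)"

definition semifinite_wrt :: "'a measure \<Rightarrow> 'a measure \<Rightarrow> bool" where
  "semifinite_wrt M N \<longleftrightarrow>
     (\<forall>E\<in>sets M. 0 < emeasure N E \<longrightarrow>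
        (\<exists>F\<in>sets M. F \<subseteq> E \<and> emeasure M F < \<infinity> \<and> 0 < emeasure N F))"

text \<open>The condition that \<open>N\<close> is infinite on all nonempty measurable subsets of the complement
  of \<open>S\<close>, with ``nonempty'' understood modulo \<open>M\<close>-null sets: an absolutely continuous \<open>N\<close>
  vanishes on those, and \<open>S\<close> is determined only up to them. The condition for all literally
  nonempty sets implies this one.\<close>

definition infinite_off :: "'a measure \<Rightarrow> 'a measure \<Rightarrow> 'a set \<Rightarrow> bool" where
  "infinite_off M N S \<longleftrightarrow>
     (\<forall>E\<in>sets M. E \<subseteq> space M - S \<and> 0 < emeasure M E \<longrightarrow> emeasure N E = \<infinity>)"

definition is_density :: "'a measure \<Rightarrow> 'a measure \<Rightarrow> ('a \<Rightarrow> ennreal) \<Rightarrow> bool" where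
  "is_density M N h \<longleftrightarrow>
     h \<in> borel_measurable M \<and> (\<forall>E\<in>sets M. emeasure N E = (\<integral>\<^sup>+x\<in>E. h x \<partial>M))"

section \<open>Integration as a functional on the positive cone\<close>

text \<open>The image is a singleton when \<open>F\<close> is a positive class for a measure with respect to which
  \<open>N\<close> is absolutely continuous.\<close>

definition integral_functional :: "'a measure \<Rightarrow> ('a \<Rightarrow> complex) set \<Rightarrow> ennreal" where
  "integral_functional N F = the_elem ((\<lambda>f. \<integral>\<^sup>+x. ennreal (Re (f x)) \<partial>N) ` F)"

text \<open>The first argument is the type of the indices of the nets.\<close>

definition normal_functional ::
    "'i itself \<Rightarrow> 'a measure \<Rightarrow> (('a \<Rightarrow> complex) set \<Rightarrow> ennreal) \<Rightarrow> bool" where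
  "normal_functional _ M \<psi> \<longleftrightarrow>
     (\<forall>(I :: 'i set) r x s.
        increasing_net (Linfty_pos M) I r x \<and> is_net_sup (Linfty_pos M) I x s \<longrightarrow>
        \<psi> s = (SUP i\<in>I. \<psi> (x i)))"

end

theory Submission
  imports Defs
begin

text \<open>On sets of finite \<open>\<mu>\<close>-measure the classical Radon--Nikodym theorem provides local densities,
  and the Dedekind property glues them to a function on \<open>X\<close>. On \<open>S\<close>, both \<open>\<nu>\<close> and the measure with
  this density are determined by their values on sets of finite \<open>\<mu>\<close>-measure, by \<open>\<mu>\<close>-semifiniteness,
  so they agree; off \<open>S\<close> a constant density \<open>0\<close> or \<open>\<infinity>\<close> does. Normality is likewise reduced to sets of
  finite \<open>\<mu>\<close>-measure, on which a sequence in the net already has the same supremum, so that monotone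
  convergence applies; off \<open>S\<close> the integrals are \<open>0\<close> or \<open>\<infinity>\<close>.\<close>

section \<open>Classes of essentially bounded functions\<close>

text \<open>The sets of finite \<open>\<mu>\<close>-measure form in general an uncountable family,
  and \<open>S\<close> need not be exhausted by countably many of them. Pointwise constructions
  therefore fail: local densities agree only almost everywhere on overlaps, and the exceptional null
  sets, one for each pair, cannot be united. The same happens with the members of a net. Suprema
  have to be taken among classes, where the Dedekind property supplies them for projections only,
  that is, for sets and not for functions. A second obstacle is that \<open>\<nu>\<close> need not
  be sigma-finite even on a set of finite \<open>\<mu>\<close>-measure. Densities must therefore be
  allowed the value \<infinity>, and the sequence in a net is selected with \<open>\<mu>\<close>,
  for which the integrals over such a set are bounded, and only afterwards transferred to
  \<open>\<nu>\<close> by absolute continuity. The dichotomy off \<open>S\<close> has this origin: a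
  subset of the complement with finite \<open>\<mu>\<close>-measure is \<open>\<mu>\<close>-null,
  hence \<open>\<nu>\<close>-null, so a \<open>\<mu>\<close>-semifinite \<open>\<nu>\<close>
  vanishes there; under (ii) \<open>\<nu>\<close> is infinite on every non-null set there.\<close>

definition ess_class :: "'a measure \<Rightarrow> ('a \<Rightarrow> complex) \<Rightarrow> ('a \<Rightarrow> complex) set" where
  "ess_class M f = ae_equal M `` {f}"

lemma mem_ess_class_iff:
  "g \<in> ess_class M f \<longleftrightarrow> f \<in> ess_bounded M \<and> g \<in> ess_bounded M \<and> (AE x in M. f x = g x)"
  by (simp add: ess_class_def ae_equal_def)

lemma ess_class_self: "f \<in> ess_bounded M \<Longrightarrow> f \<in> ess_class M f"
  by (simp add: mem_ess_class_iff)

lemma ess_boundedI: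
  assumes "f \<in> borel_measurable M" "AE x in M. norm (f x) \<le> C"
  shows "f \<in> ess_bounded M"
  using assms by (auto simp: ess_bounded_def)

lemma ess_bounded_measurable: "f \<in> ess_bounded M \<Longrightarrow> f \<in> borel_measurable M"
  by (simp add: ess_bounded_def)

lemma indicator_ess_bounded: "E \<in> sets M \<Longrightarrow> indicator E \<in> ess_bounded M"
  by (rule ess_boundedI[where C=1]) (auto simp: indicator_def)

lemma mem_Linfty_iff: "F \<in> Linfty M \<longleftrightarrow> (\<exists>f\<in>ess_bounded M. F = ess_class M f)"
  by (auto simp: Linfty_def quotient_def ess_class_def)

lemma Linfty_le_ess_class_iff:
  assumes "f \<in> ess_bounded M" "g \<in> ess_bounded M"
  shows "Linfty_le M (ess_class M f) (ess_class M g) \<longleftrightarrow> (AE x in M. f x \<le> g x)"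
proof
  assume "Linfty_le M (ess_class M f) (ess_class M g)"
  then obtain f' g' where "AE x in M. f x = f' x" "AE x in M. g x = g' x" "AE x in M. f' x \<le> g' x"
    by (auto simp: Linfty_le_def mem_ess_class_iff)
  then show "AE x in M. f x \<le> g x"
    by eventually_elim simp
next
  assume "AE x in M. f x \<le> g x"
  then show "Linfty_le M (ess_class M f) (ess_class M g)"
    using ess_class_self[OF assms(1)] ess_class_self[OF assms(2)] by (auto simp: Linfty_le_def)
qed

lemma Linfty_le_indicator_iff:
  assumes "A \<in> sets M" "B \<in> sets M"
  shows "Linfty_le M (ess_class M (indicator A)) (ess_class M (indicator B)) \<longleftrightarrow>
    (AE x in M. x \<in> A \<longrightarrow> x \<in> B)"
proof -
  have "(indicator A x :: complex) \<le> indicator B x \<longleftrightarrow> (x \<in> A \<longrightarrow> x \<in> B)" for x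
    by (auto simp: indicator_def less_eq_complex_def)
  then show ?thesis
    using assms by (simp add: Linfty_le_ess_class_iff indicator_ess_bounded)
qed

lemma Linfty_pos_carrier_iff:
  "F \<in> carrier (Linfty_pos M) \<longleftrightarrow>
    (\<exists>f\<in>ess_bounded M. F = ess_class M f \<and> (AE x in M. 0 \<le> f x))"
proof
  assume "F \<in> carrier (Linfty_pos M)"
  then obtain f g where f: "f \<in> ess_bounded M" "F = ess_class M f" "g \<in> F" "AE x in M. 0 \<le> g x"
    by (auto simp: Linfty_pos_def mem_Linfty_iff)
  then have "AE x in M. f x = g x"
    by (simp add: mem_ess_class_iff)
  with f(4) have "AE x in M. 0 \<le> f x"
    by eventually_elim simp
  with f show "\<exists>f\<in>ess_bounded M. F = ess_class M f \<and> (AE x in M. 0 \<le> f x)"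
    by blast
next
  assume "\<exists>f\<in>ess_bounded M. F = ess_class M f \<and> (AE x in M. 0 \<le> f x)"
  then show "F \<in> carrier (Linfty_pos M)"
    using ess_class_self[of _ M] by (auto simp: Linfty_pos_def mem_Linfty_iff)
qed

lemma integral_functional_ess_class:
  assumes "sets N = sets M" "absolutely_continuous M N" "f \<in> ess_bounded M"
  shows "integral_functional N (ess_class M f) = (\<integral>\<^sup>+x. ennreal (Re (f x)) \<partial>N)"
proof -
  have "(\<integral>\<^sup>+x. ennreal (Re (g x)) \<partial>N) = (\<integral>\<^sup>+x. ennreal (Re (f x)) \<partial>N)" if "g \<in> ess_class M f" for g
  proof (rule nn_integral_cong_AE)
    have "AE x in M. f x = g x"
      using that by (simp add: mem_ess_class_iff)
    then have "AE x in N. f x = g x"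
      by (rule absolutely_continuous_AE[OF assms(1,2)])
    then show "AE x in N. ennreal (Re (g x)) = ennreal (Re (f x))"
      by eventually_elim simp
  qed
  then have "(\<lambda>g. \<integral>\<^sup>+x. ennreal (Re (g x)) \<partial>N) ` ess_class M f =
      (\<lambda>_. \<integral>\<^sup>+x. ennreal (Re (f x)) \<partial>N) ` ess_class M f"
    by (rule image_cong[OF refl])
  also have "\<dots> = {\<integral>\<^sup>+x. ennreal (Re (f x)) \<partial>N}"
    by (rule image_constant[OF ess_class_self[OF assms(3)]])
  finally show ?thesis
    by (simp add: integral_functional_def)
qed

text \<open>Translates the Dedekind property from nets of projections to families of sets.
  Directedness is asked only up to null sets, which is all that families built from local densities
  can offer.\<close>

lemma Dedekind_ess_sup:
  assumes "Dedekind M" "\<A> \<subseteq> sets M" "\<A> \<noteq> {}"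
    and dir: "\<And>A B. A \<in> \<A> \<Longrightarrow> B \<in> \<A> \<Longrightarrow> \<exists>C\<in>\<A>. AE x in M. x \<in> A \<union> B \<longrightarrow> x \<in> C"
  obtains U where "U \<in> sets M" "\<And>A. A \<in> \<A> \<Longrightarrow> AE x in M. x \<in> A \<longrightarrow> x \<in> U"
    "\<And>V. V \<in> sets M \<Longrightarrow> (\<And>A. A \<in> \<A> \<Longrightarrow> AE x in M. x \<in> A \<longrightarrow> x \<in> V) \<Longrightarrow> AE x in M. x \<in> U \<longrightarrow> x \<in> V"
proof -
  define c where "c A = ess_class M (indicator A)" for A
  \<comment> \<open>The net is indexed by its own range, because \<open>Dedekind\<close> quantifies
    over index sets consisting of classes; the sets in \<open>\<A>\<close> themselves have the wrong
    type. Restricting \<open>r\<close> to this range is what \<open>preorder_on\<close>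
    demands.\<close>
  define r where "r = {(P, Q). P \<in> c ` \<A> \<and> Q \<in> c ` \<A> \<and> Linfty_le M P Q}"
  have le: "Linfty_le M (c A) (c B) \<longleftrightarrow> (AE x in M. x \<in> A \<longrightarrow> x \<in> B)"
    if "A \<in> sets M" "B \<in> sets M" for A B
    unfolding c_def by (rule Linfty_le_indicator_iff[OF that])
  have sets: "A \<in> sets M" if "A \<in> \<A>" for A
    using that assms(2) by auto
  have carr: "carrier (projections M) = c ` sets M"
    by (auto simp: projections_def c_def ess_class_def)
  have "trans r"
  proof (rule transI)
    fix P Q R assume "(P, Q) \<in> r" "(Q, R) \<in> r"
    then obtain A B C where *: "A \<in> \<A>" "B \<in> \<A>" "C \<in> \<A>" "P = c A" "Q = c B" "R = c C"
      "AE x in M. x \<in> A \<longrightarrow> x \<in> B" "AE x in M. x \<in> B \<longrightarrow> x \<in> C"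
      by (auto simp: r_def le sets)
    from *(7,8) have "AE x in M. x \<in> A \<longrightarrow> x \<in> C"
      by eventually_elim auto
    with * show "(P, R) \<in> r"
      by (auto simp: r_def le sets)
  qed
  then have "preorder_on (c ` \<A>) r"
    by (auto simp: preorder_on_def r_def refl_on_def le sets)
  moreover have "\<exists>R\<in>c ` \<A>. (P, R) \<in> r \<and> (Q, R) \<in> r" if PQ: "P \<in> c ` \<A>" "Q \<in> c ` \<A>" for P Q
  proof -
    obtain A B where *: "A \<in> \<A>" "B \<in> \<A>" "P = c A" "Q = c B"
      using PQ by auto
    obtain C where C: "C \<in> \<A>" "AE x in M. x \<in> A \<union> B \<longrightarrow> x \<in> C"
      using dir *(1,2) by blast
    have "AE x in M. x \<in> A \<longrightarrow> x \<in> C" "AE x in M. x \<in> B \<longrightarrow> x \<in> C"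
      using C(2) by (auto elim: eventually_mono)
    then have "(P, c C) \<in> r" "(Q, c C) \<in> r"
      using * C(1) by (auto simp: r_def le sets)
    then show ?thesis
      using C(1) by blast
  qed
  moreover have "(\<lambda>P. P) \<in> c ` \<A> \<rightarrow> carrier (projections M)"
    using assms(2) unfolding carr by blast
  moreover have "\<forall>(P, Q)\<in>r. P \<sqsubseteq>\<^bsub>projections M\<^esub> Q"
    by (auto simp: r_def projections_def)
  moreover have "c ` \<A> \<noteq> {}"
    using assms(3) by simp
  ultimately have "increasing_net (projections M) (c ` \<A>) r (\<lambda>P. P)"
    unfolding increasing_net_def by blast
  then have "\<exists>s. is_net_sup (projections M) (c ` \<A>) (\<lambda>P. P) s"
    using assms(1) unfolding Dedekind_def by blast
  then obtain s where s: "least (projections M) s (Upper (projections M) (c ` \<A>))"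
    unfolding is_net_sup_def image_ident by blast
  have upper: "c V \<in> Upper (projections M) (c ` \<A>) \<longleftrightarrow>
      (\<forall>A\<in>\<A>. AE x in M. x \<in> A \<longrightarrow> x \<in> V)" if "V \<in> sets M" for V
    using that sets unfolding Upper_def carr by (auto simp: projections_def le)
  have "s \<in> Upper (projections M) (c ` \<A>)"
    using s by (simp add: least_def)
  then obtain U where U: "U \<in> sets M" "s = c U"
    unfolding Upper_def carr by blast
  with \<open>s \<in> _\<close> have ub: "\<forall>A\<in>\<A>. AE x in M. x \<in> A \<longrightarrow> x \<in> U"
    using upper[of U] by blast
  have lub: "AE x in M. x \<in> U \<longrightarrow> x \<in> V" if V: "V \<in> sets M" "\<And>A. A \<in> \<A> \<Longrightarrow> AE x in M. x \<in> A \<longrightarrow> x \<in> V" for V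
  proof -
    have "Linfty_le M s (c V)"
      using s upper[OF V(1)] V(2) by (auto simp: least_def projections_def)
    then show ?thesis
      using U V le by simp
  qed
  show thesis
    using that U ub lub by blast
qed

section \<open>Semifiniteness\<close>

text \<open>In place of a restriction to \<open>F\<close>, most arguments use
  \<open>density M (indicator F)\<close>: it keeps the space and the sigma-algebra, so measurability
  and equality of measures need no translation.\<close>

lemma AE_density_indicator:
  "F \<in> sets M \<Longrightarrow> (AE x in density M (indicator F). P x) \<longleftrightarrow> (AE x in M. x \<in> F \<longrightarrow> P x)"
  by (subst AE_density) (auto simp: indicator_def intro!: AE_cong)

lemma emeasure_density_indicator:
  "F \<in> sets M \<Longrightarrow> E \<in> sets M \<Longrightarrow> emeasure (density M (indicator F)) E = emeasure M (F \<inter> E)"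
  by (subst emeasure_density) (auto simp: indicator_inter_arith[symmetric])

lemma finite_measure_density_indicator:
  assumes "F \<in> sets M" "emeasure M F < \<infinity>"
  shows "finite_measure (density M (indicator F))"
proof (rule finite_measureI)
  show "emeasure (density M (indicator F)) (space (density M (indicator F))) \<noteq> \<infinity>"
    using assms by (simp add: emeasure_density_indicator less_top)
qed

lemma semifinite_wrtD:
  assumes "semifinite_wrt M N" "E \<in> sets M" "0 < emeasure N E"
  obtains F where "F \<in> sets M" "F \<subseteq> E" "emeasure M F < \<infinity>" "0 < emeasure N F"
  using assms unfolding semifinite_wrt_def by blast

text \<open>Exhaustion: if the supremum is finite, let \<open>?U\<close> be the union of an
  increasing sequence of admissible sets along which it is attained. Were \<open>E - ?U\<close> not
  \<open>N\<close>-null, it would contain an admissible \<open>K\<close> with positive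
  \<open>N\<close>-measure, and adding \<open>K\<close> to the sequence would push the finite
  supremum above itself.\<close>

lemma semifinite_wrt_emeasure_eq_SUP:
  assumes "semifinite_wrt M N" and [simp]: "sets N = sets M" and E: "E \<in> sets M"
  shows "emeasure N E = (SUP F\<in>{F \<in> sets M. F \<subseteq> E \<and> emeasure M F < \<infinity>}. emeasure N F)"
    (is "_ = (SUP F\<in>?\<F>. _)")
proof (rule antisym)
  let ?\<alpha> = "SUP F\<in>?\<F>. emeasure N F"
  show "?\<alpha> \<le> emeasure N E"
    by (rule SUP_least) (auto intro!: emeasure_mono E)
  show "emeasure N E \<le> ?\<alpha>"
  proof (cases "?\<alpha> = \<infinity>")
    case False
    have "?\<F> \<noteq> {}"
      by (auto intro!: exI[of _ "{}"])
    then obtain a where a: "range a \<subseteq> emeasure N ` ?\<F>" "?\<alpha> = (SUP n::nat. a n)"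
      using ennreal_SUP_countable_SUP[of ?\<F> "emeasure N"] by auto
    then have "\<forall>n. \<exists>F. F \<in> ?\<F> \<and> a n = emeasure N F"
      by blast
    from choice[OF this] obtain F where F: "\<And>n. F n \<in> ?\<F>" "\<And>n. a n = emeasure N (F n)"
      by blast
    \<comment> \<open>The sets \<open>F n\<close> come from a maximizing sequence and need not
      increase; their finite unions do, and they still have finite \<open>M\<close>-measure.\<close>
    define G where "G n = (\<Union>i\<le>n. F i)" for n
    have fin: "emeasure M (G n) < \<infinity>" for n
    proof -
      have "emeasure M (G n) \<le> (\<Sum>i\<le>n. emeasure M (F i))"
        unfolding G_def using F(1) by (intro emeasure_subadditive_finite) auto
      also have "\<dots> < \<infinity>"
        using F(1) by auto
      finally show ?thesis .
    qed
    have G: "G n \<in> ?\<F>" for n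
      using F(1) fin[of n] by (auto simp: G_def)
    have inc: "incseq G"
      by (force simp: incseq_def G_def)
    have le: "emeasure N K \<le> ?\<alpha>" if "K \<in> ?\<F>" for K
      using that by (rule SUP_upper)
    let ?U = "\<Union>n. G n"
    have [measurable]: "?U \<in> sets M"
      using G(1) by (intro sets.countable_UN) blast
    have "emeasure N ?U = ?\<alpha>"
    proof (rule antisym)
      have "emeasure N ?U = (SUP n. emeasure N (G n))"
        using G inc by (intro SUP_emeasure_incseq[symmetric]) auto
      also have "\<dots> \<le> ?\<alpha>"
        using G le by (intro SUP_least) blast
      finally show "emeasure N ?U \<le> ?\<alpha>" .
      show "?\<alpha> \<le> emeasure N ?U"
        unfolding a(2) F(2)
      proof (intro SUP_least emeasure_mono)
        show "F n \<subseteq> ?U" for n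
          by (auto simp: G_def)
      qed simp
    qed
    have "emeasure N (E - ?U) = 0"
    proof (rule ccontr)
      assume "emeasure N (E - ?U) \<noteq> 0"
      then obtain K where K: "K \<in> sets M" "K \<subseteq> E - ?U" "emeasure M K < \<infinity>" "0 < emeasure N K"
        using semifinite_wrtD[OF assms(1), of "E - ?U"] E by (auto simp: zero_less_iff_neq_zero)
      have "emeasure N (G n) + emeasure N K \<le> ?\<alpha>" for n
      proof -
        have "emeasure N (G n) + emeasure N K = emeasure N (G n \<union> K)"
          using G[of n] K by (intro plus_emeasure) auto
        also have "\<dots> \<le> ?\<alpha>"
        proof (rule le)
          have "emeasure M (G n \<union> K) \<le> emeasure M (G n) + emeasure M K"
            using G[of n] K by (intro emeasure_subadditive) auto
          also have "\<dots> < \<infinity>"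
            using G[of n] K by auto
          finally show "G n \<union> K \<in> ?\<F>"
            using G[of n] K by auto
        qed
        finally show ?thesis .
      qed
      then have "(SUP n. emeasure N (G n) + emeasure N K) \<le> ?\<alpha>"
        by (intro SUP_least)
      moreover have "(SUP n. emeasure N (G n) + emeasure N K) = (SUP n. emeasure N (G n)) + emeasure N K"
        by (rule ennreal_SUP_add_left) simp
      moreover have "(SUP n. emeasure N (G n)) = emeasure N ?U"
        using G inc by (intro SUP_emeasure_incseq) auto
      ultimately have "emeasure N ?U + emeasure N K \<le> ?\<alpha>"
        by simp
      then show False
        using \<open>emeasure N ?U = ?\<alpha>\<close> K(4) False
        by (metis add.right_neutral ennreal_add_left_cancel_le infinity_ennreal_def not_less)
    qed
    then have "emeasure N E \<le> emeasure N (?U)"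
      using emeasure_subadditive[of ?U N "E - ?U"] emeasure_mono[of E "?U \<union> (E - ?U)" N] E
      by (auto intro: order_trans)
    then show ?thesis
      using \<open>emeasure N ?U = ?\<alpha>\<close> by simp
  next
    case True
    show ?thesis
      unfolding True by simp
  qed
qed

text \<open>The device that passes from equality on sets of finite measure to equality everywhere,
  since both values are suprema over the same family.\<close>

lemma semifinite_wrt_eqI:
  assumes "semifinite_wrt M N" "semifinite_wrt M N'" "sets N = sets M" "sets N' = sets M"
    and "\<And>F. F \<in> sets M \<Longrightarrow> emeasure M F < \<infinity> \<Longrightarrow> emeasure N F = emeasure N' F"
  shows "N = N'"
proof (rule measure_eqI)
  fix E assume "E \<in> sets N"
  then have E: "E \<in> sets M"
    using assms(3) by simp
  show "emeasure N E = emeasure N' E"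
    unfolding semifinite_wrt_emeasure_eq_SUP[OF assms(1,3) E]
      semifinite_wrt_emeasure_eq_SUP[OF assms(2,4) E]
    using assms(5) by (intro SUP_cong) auto
qed (use assms in simp)

section \<open>Semifiniteness under densities and restrictions\<close>

lemma emeasure_density_eq_0_iff:
  assumes "q \<in> borel_measurable N" "E \<in> sets N"
  shows "emeasure (density N q) E = 0 \<longleftrightarrow> emeasure N {x \<in> E. q x \<noteq> 0} = 0"
proof -
  have [measurable]: "q \<in> borel_measurable N" "E \<in> sets N"
    using assms by auto
  have eq: "{x \<in> space N. q x \<noteq> 0 \<and> indicator E x \<noteq> (0::ennreal)} = {x \<in> E. q x \<noteq> 0}"
    using sets.sets_into_space[OF assms(2)] by (auto simp: indicator_def split: if_splits)
  show ?thesis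
    by (subst emeasure_density) (simp_all add: nn_integral_0_iff eq)
qed

text \<open>A set is null for \<open>density N q\<close> exactly when its part with \<open>q\<close>
  nonzero is \<open>N\<close>-null. So the finite set is sought inside that part, where every set of
  positive \<open>N\<close>-measure also has positive measure for the density.\<close>

lemma semifinite_wrt_density:
  assumes "semifinite_wrt M N" "sets N = sets M" "q \<in> borel_measurable N"
  shows "semifinite_wrt M (density N q)"
  unfolding semifinite_wrt_def
proof (intro ballI impI)
  fix E assume E: "E \<in> sets M" "0 < emeasure (density N q) E"
  have [measurable]: "q \<in> borel_measurable N" "E \<in> sets N"
    using assms E by auto
  have "{x \<in> E. q x \<noteq> 0} = {x \<in> space N. x \<in> E \<and> q x \<noteq> 0}"
    using sets.sets_into_space[OF \<open>E \<in> sets N\<close>] by auto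
  also have "\<dots> \<in> sets N"
    by measurable
  finally have meas: "{x \<in> E. q x \<noteq> 0} \<in> sets M"
    using assms(2) by simp
  have "0 < emeasure N {x \<in> E. q x \<noteq> 0}"
    using E(2) emeasure_density_eq_0_iff[of q N E] by (auto simp: zero_less_iff_neq_zero)
  then obtain F where F: "F \<in> sets M" "F \<subseteq> {x \<in> E. q x \<noteq> 0}" "emeasure M F < \<infinity>" "0 < emeasure N F"
    using semifinite_wrtD[OF assms(1) meas] by blast
  have "{x \<in> F. q x \<noteq> 0} = F"
    using F(2) by auto
  then have "0 < emeasure (density N q) F"
    using emeasure_density_eq_0_iff[of q N F] F assms by (auto simp: zero_less_iff_neq_zero)
  with F show "\<exists>F\<in>sets M. F \<subseteq> E \<and> emeasure M F < \<infinity> \<and> 0 < emeasure (density N q) F"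
    by blast
qed

text \<open>\<open>semifinite\<close> speaks only of sets of infinite measure; a set of positive
  finite measure is its own witness.\<close>

lemma semifinite_restrict_spaceD:
  assumes "semifinite (restrict_space M S)" "S \<in> sets M" "E \<in> sets M" "E \<subseteq> S" "0 < emeasure M E"
  obtains F where "F \<in> sets M" "F \<subseteq> E" "0 < emeasure M F" "emeasure M F < \<infinity>"
proof (cases "emeasure M E = \<infinity>")
  case True
  have S: "S \<inter> space M \<in> sets M"
    using assms(2) by simp
  have "E \<in> sets (restrict_space M S)" "emeasure (restrict_space M S) E = \<infinity>"
    using assms(3,4) True by (simp_all add: sets_restrict_space_iff[OF S] emeasure_restrict_space[OF S])
  then obtain F where F: "F \<in> sets (restrict_space M S)" "F \<subseteq> E"
    "0 < emeasure (restrict_space M S) F" "emeasure (restrict_space M S) F < \<infinity>"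
    using assms(1) unfolding semifinite_def by blast
  then show thesis
    using that[of F] assms(4) by (simp add: sets_restrict_space_iff[OF S] emeasure_restrict_space[OF S])
next
  case False
  then show thesis
    using that[of E] assms by (simp add: less_top)
qed

lemma semifinite_restrict_spaceI:
  assumes "S \<in> sets M"
    and "\<And>E. E \<in> sets M \<Longrightarrow> E \<subseteq> S \<Longrightarrow> emeasure M E = \<infinity> \<Longrightarrow>
      \<exists>F\<in>sets M. F \<subseteq> E \<and> 0 < emeasure M F \<and> emeasure M F < \<infinity>"
  shows "semifinite (restrict_space M S)"
  unfolding semifinite_def
proof (intro ballI impI)
  have S: "S \<inter> space M \<in> sets M"
    using assms(1) by simp
  fix E assume "E \<in> sets (restrict_space M S)" "emeasure (restrict_space M S) E = \<infinity>"
  then have E: "E \<in> sets M" "E \<subseteq> S" "emeasure M E = \<infinity>"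
    by (simp_all add: sets_restrict_space_iff[OF S] emeasure_restrict_space[OF S])
  then obtain F where F: "F \<in> sets M" "F \<subseteq> E" "0 < emeasure M F" "emeasure M F < \<infinity>"
    using assms(2) by blast
  then have "F \<subseteq> S"
    using E(2) by blast
  then show "\<exists>F\<in>sets (restrict_space M S). F \<subseteq> E \<and>
      0 < emeasure (restrict_space M S) F \<and> emeasure (restrict_space M S) F < \<infinity>"
    using F by (intro bexI[of _ F]) (simp_all add: sets_restrict_space_iff[OF S] emeasure_restrict_space[OF S])
qed

lemma semifinite_wrt_restrict_space_iff:
  assumes "S \<in> sets M" "sets N = sets M"
  shows "semifinite_wrt (restrict_space M S) (restrict_space N S) \<longleftrightarrow>
    (\<forall>E\<in>sets M. E \<subseteq> S \<and> 0 < emeasure N E \<longrightarrow>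
      (\<exists>F\<in>sets M. F \<subseteq> E \<and> emeasure M F < \<infinity> \<and> 0 < emeasure N F))" (is "?L \<longleftrightarrow> ?R")
proof -
  have S: "S \<inter> space M \<in> sets M" "S \<inter> space N \<in> sets N"
    using assms by simp_all
  have r: "E \<in> sets (restrict_space M S) \<longleftrightarrow> E \<subseteq> S \<and> E \<in> sets M"
    "E \<subseteq> S \<Longrightarrow> emeasure (restrict_space M S) E = emeasure M E"
    "E \<subseteq> S \<Longrightarrow> emeasure (restrict_space N S) E = emeasure N E" for E
    by (simp_all add: sets_restrict_space_iff[OF S(1)] emeasure_restrict_space[OF S(1)]
        emeasure_restrict_space[OF S(2)])
  show ?thesis
  proof
    assume L: ?L
    show ?R
    proof (intro ballI impI)
      fix E assume E: "E \<in> sets M" "E \<subseteq> S \<and> 0 < emeasure N E"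
      then obtain F where "F \<in> sets (restrict_space M S)" "F \<subseteq> E"
        "emeasure (restrict_space M S) F < \<infinity>" "0 < emeasure (restrict_space N S) F"
        using semifinite_wrtD[OF L, of E] by (auto simp: r)
      then show "\<exists>F\<in>sets M. F \<subseteq> E \<and> emeasure M F < \<infinity> \<and> 0 < emeasure N F"
        by (intro bexI[of _ F]) (simp_all add: r)
    qed
  next
    assume R: ?R
    show ?L
      unfolding semifinite_wrt_def
    proof (intro ballI impI)
      fix E assume "E \<in> sets (restrict_space M S)" "0 < emeasure (restrict_space N S) E"
      then have E: "E \<subseteq> S" "E \<in> sets M" "0 < emeasure N E"
        by (simp_all add: r)
      then obtain F where F: "F \<in> sets M" "F \<subseteq> E" "emeasure M F < \<infinity>" "0 < emeasure N F"
        using R by blast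
      moreover have "F \<subseteq> S"
        using F E by blast
      ultimately show "\<exists>F\<in>sets (restrict_space M S). F \<subseteq> E \<and>
          emeasure (restrict_space M S) F < \<infinity> \<and> 0 < emeasure (restrict_space N S) F"
        by (intro bexI[of _ F]) (simp_all add: r)
    qed
  qed
qed

lemma semifinite_wrt_density_indicator:
  assumes "S \<in> sets M" "sets N = sets M"
    and "semifinite_wrt (restrict_space M S) (restrict_space N S)"
  shows "semifinite_wrt M (density N (indicator S))"
  unfolding semifinite_wrt_def
proof (intro ballI impI)
  fix E assume E: "E \<in> sets M" "0 < emeasure (density N (indicator S)) E"
  then have "S \<inter> E \<in> sets M" "0 < emeasure N (S \<inter> E)"
    using assms(1,2) by (auto simp: emeasure_density_indicator)
  then obtain F where F: "F \<in> sets M" "F \<subseteq> S \<inter> E" "emeasure M F < \<infinity>" "0 < emeasure N F"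
    using assms(3) unfolding semifinite_wrt_restrict_space_iff[OF assms(1,2)] by (meson Int_lower1)
  moreover have "S \<inter> F = F" "F \<subseteq> E"
    using F(2) by auto
  ultimately show "\<exists>F\<in>sets M. F \<subseteq> E \<and> emeasure M F < \<infinity> \<and> 0 < emeasure (density N (indicator S)) F"
    using assms(1,2) by (intro bexI[of _ F]) (simp_all add: emeasure_density_indicator)
qed

text \<open>If the exceptional set were not null, semifiniteness would yield a subset of positive
  finite measure on which \<open>P\<close> fails everywhere, against \<open>fin\<close>.\<close>

lemma AE_semifiniteI:
  assumes "semifinite (restrict_space M S)" "S \<in> sets M"
    and meas: "{x \<in> space M. x \<in> S \<and> \<not> P x} \<in> sets M"
    and fin: "\<And>F. F \<in> sets M \<Longrightarrow> F \<subseteq> S \<Longrightarrow> emeasure M F < \<infinity> \<Longrightarrow> AE x in M. x \<in> F \<longrightarrow> P x"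
  shows "AE x in M. x \<in> S \<longrightarrow> P x"
proof -
  let ?E = "{x \<in> space M. x \<in> S \<and> \<not> P x}"
  have "emeasure M ?E = 0"
  proof (rule ccontr)
    assume "emeasure M ?E \<noteq> 0"
    then have pos: "0 < emeasure M ?E"
      by (simp add: zero_less_iff_neq_zero)
    have "?E \<subseteq> S"
      by blast
    then obtain F where F: "F \<in> sets M" "F \<subseteq> ?E" "0 < emeasure M F" "emeasure M F < \<infinity>"
      by (rule semifinite_restrict_spaceD[OF assms(1,2) meas _ pos])
    have "F \<subseteq> S"
      using F(2) by blast
    from fin[OF F(1) this F(4)] have "AE x in M. x \<notin> F"
      by eventually_elim (use F(2) in blast)
    then have "emeasure M F = 0"
      using F(1) by (simp add: AE_iff_null_sets[symmetric] null_setsD1)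
    with F(3) show False
      by simp
  qed
  then show ?thesis
    using meas by (subst AE_iff_measurable[where N="?E"]) auto
qed

section \<open>Local densities and their gluing\<close>

lemma emeasure_density_density_indicator:
  assumes [measurable]: "F \<in> sets M" "h \<in> borel_measurable M" "E \<in> sets M"
  shows "emeasure (density (density M (indicator F)) h) E = (\<integral>\<^sup>+x\<in>F \<inter> E. h x \<partial>M)"
proof -
  have "emeasure (density (density M (indicator F)) h) E =
      (\<integral>\<^sup>+x. indicator F x * (h x * indicator E x) \<partial>M)"
    by (simp add: emeasure_density nn_integral_density)
  also have "\<dots> = (\<integral>\<^sup>+x\<in>F \<inter> E. h x \<partial>M)"
    by (rule nn_integral_cong) (simp add: indicator_def)
  finally show ?thesis .
qed

text \<open>Cutting \<open>M\<close> down to \<open>F\<close> gives a finite measure, for which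
  densities are unique even when they take the value \<infinity> or have infinite integrals.\<close>

lemma density_unique_on_finite:
  assumes "F \<in> sets M" "emeasure M F < \<infinity>" "h \<in> borel_measurable M" "h' \<in> borel_measurable M"
    and eq: "\<And>E. E \<in> sets M \<Longrightarrow> E \<subseteq> F \<Longrightarrow> (\<integral>\<^sup>+x\<in>E. h x \<partial>M) = (\<integral>\<^sup>+x\<in>E. h' x \<partial>M)"
  shows "AE x in M. x \<in> F \<longrightarrow> h x = h' x"
proof -
  interpret finite_measure "density M (indicator F)"
    using assms(1,2) by (rule finite_measure_density_indicator)
  have "density (density M (indicator F)) h = density (density M (indicator F)) h'"
    by (rule measure_eqI) (use assms in \<open>simp_all add: emeasure_density_density_indicator\<close>)
  then have "AE x in density M (indicator F). h x = h' x"
    using assms by (intro density_unique) simp_all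
  then show ?thesis
    using assms(1) by (simp add: AE_density_indicator)
qed

text \<open>\<open>Radon_Nikodym\<close> over the finite measure
  \<open>density M (indicator F)\<close> admits an arbitrary absolutely continuous second measure.
  So \<open>N\<close> may be infinite on \<open>F\<close>, and the density may take the value
  \<infinity>.\<close>

lemma Radon_Nikodym_on_finite:
  assumes "F \<in> sets M" "emeasure M F < \<infinity>" "sets N = sets M" "absolutely_continuous M N"
  shows "\<exists>h\<in>borel_measurable M. \<forall>E\<in>sets M. E \<subseteq> F \<longrightarrow> emeasure N E = (\<integral>\<^sup>+x\<in>E. h x \<partial>M)"
proof -
  interpret finite_measure "density M (indicator F)"
    using assms(1,2) by (rule finite_measure_density_indicator)
  have "absolutely_continuous (density M (indicator F)) (density N (indicator F))"
    unfolding absolutely_continuous_def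
  proof
    fix E assume "E \<in> null_sets (density M (indicator F))"
    then have "E \<in> sets M" "emeasure M (F \<inter> E) = 0"
      using assms(1) by (auto simp: null_sets_def emeasure_density_indicator)
    moreover from this have "emeasure N (F \<inter> E) = 0"
      using assms by (intro absolutely_continuousD[OF assms(4)]) auto
    ultimately show "E \<in> null_sets (density N (indicator F))"
      using assms by (auto simp: null_sets_def emeasure_density_indicator)
  qed
  from Radon_Nikodym[OF this] obtain h where h: "h \<in> borel_measurable M"
    "density (density M (indicator F)) h = density N (indicator F)"
    using assms(3) by auto
  have "emeasure N E = (\<integral>\<^sup>+x\<in>E. h x \<partial>M)" if "E \<in> sets M" "E \<subseteq> F" for E
  proof -
    have "F \<inter> E = E"
      using that(2) by blast
    then show ?thesis
      using emeasure_density_density_indicator[OF assms(1) h(1) that(1)] h(2) assms(1,3) that(1)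
      by (simp add: emeasure_density_indicator)
  qed
  with h(1) show ?thesis
    by blast
qed

text \<open>The local densities are glued through their superlevel sets: for each of countably many
  levels, the superlevel sets of the local densities form a directed family, whose essential
  supremum is the superlevel set of the global density.\<close>

lemma Dedekind_density_on_finite:
  assumes "Dedekind M" "sets N = sets M" "absolutely_continuous M N"
  shows "\<exists>h\<in>borel_measurable M. \<forall>F\<in>sets M. emeasure M F < \<infinity> \<longrightarrow>
    emeasure N F = (\<integral>\<^sup>+x\<in>F. h x \<partial>M)"
proof -
  define \<F> where "\<F> = {F \<in> sets M. emeasure M F < \<infinity>}"
  have "\<forall>F\<in>\<F>. \<exists>h. h \<in> borel_measurable M \<and> (\<forall>E\<in>sets M. E \<subseteq> F \<longrightarrow> emeasure N E = (\<integral>\<^sup>+x\<in>E. h x \<partial>M))"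
    using Radon_Nikodym_on_finite[OF _ _ assms(2,3)] unfolding \<F>_def by blast
  from bchoice[OF this] obtain k where
    k [measurable]: "\<And>F. F \<in> \<F> \<Longrightarrow> k F \<in> borel_measurable M" and
    k_eq: "\<And>F E. F \<in> \<F> \<Longrightarrow> E \<in> sets M \<Longrightarrow> E \<subseteq> F \<Longrightarrow> emeasure N E = (\<integral>\<^sup>+x\<in>E. k F x \<partial>M)"
    by blast
  have sets: "F \<in> sets M" if "F \<in> \<F>" for F
    using that by (simp add: \<F>_def)
  have compat: "AE x in M. x \<in> F \<inter> G \<longrightarrow> k F x = k G x" if FG: "F \<in> \<F>" "G \<in> \<F>" for F G
  proof (rule density_unique_on_finite)
    show "F \<inter> G \<in> sets M" "k F \<in> borel_measurable M" "k G \<in> borel_measurable M"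
      using FG k sets by auto
    have "emeasure M (F \<inter> G) \<le> emeasure M F"
      using FG sets by (intro emeasure_mono) auto
    also have "\<dots> < \<infinity>"
      using FG by (simp add: \<F>_def)
    finally show "emeasure M (F \<inter> G) < \<infinity>" .
    fix E assume "E \<in> sets M" "E \<subseteq> F \<inter> G"
    then show "(\<integral>\<^sup>+x\<in>E. k F x \<partial>M) = (\<integral>\<^sup>+x\<in>E. k G x \<partial>M)"
      using k_eq[OF FG(1), of E] k_eq[OF FG(2), of E] by simp
  qed
  have un: "F \<union> G \<in> \<F>" if FG: "F \<in> \<F>" "G \<in> \<F>" for F G
  proof -
    have "emeasure M (F \<union> G) \<le> emeasure M F + emeasure M G"
      using FG sets by (intro emeasure_subadditive) auto
    also have "\<dots> < \<infinity>"
      using FG by (simp add: \<F>_def)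
    finally show ?thesis
      using sets[OF FG(1)] sets[OF FG(2)] by (simp add: \<F>_def)
  qed
  define A where "A d F = {x \<in> space M. x \<in> F \<and> d < k F x}" for d F
  have A [measurable]: "A d F \<in> sets M" if "F \<in> \<F>" for d F
  proof -
    have [measurable]: "F \<in> sets M" "k F \<in> borel_measurable M"
      using sets[OF that] k[OF that] by auto
    show ?thesis
      unfolding A_def by measurable
  qed
  have "\<exists>U\<in>sets M. (\<forall>F\<in>\<F>. AE x in M. x \<in> F \<longrightarrow> (x \<in> U \<longleftrightarrow> d < k F x))" for d
  proof -
    have "{} \<in> \<F>"
      by (simp add: \<F>_def)
    then have ne: "A d ` \<F> \<noteq> {}"
      by blast
    \<comment> \<open>The function \<open>k (F \<union> G)\<close> was chosen independently of
      \<open>k F\<close> and \<open>k G\<close> and agrees with them only almost everywhere, so the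
      family is directed only modulo null sets.\<close>
    have dir: "\<exists>C\<in>A d ` \<F>. AE x in M. x \<in> P \<union> Q \<longrightarrow> x \<in> C"
      if PQ: "P \<in> A d ` \<F>" "Q \<in> A d ` \<F>" for P Q
    proof -
      obtain F G where *: "F \<in> \<F>" "G \<in> \<F>" "P = A d F" "Q = A d G"
        using PQ by blast
      have "AE x in M. x \<in> P \<union> Q \<longrightarrow> x \<in> A d (F \<union> G)"
        using compat[OF *(1) un[OF *(1,2)]] compat[OF *(2) un[OF *(1,2)]]
        by eventually_elim (auto simp: * A_def)
      then show ?thesis
        using un[OF *(1,2)] by blast
    qed
    obtain U where U: "U \<in> sets M" "\<And>B. B \<in> A d ` \<F> \<Longrightarrow> AE x in M. x \<in> B \<longrightarrow> x \<in> U"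
      "\<And>V. V \<in> sets M \<Longrightarrow> (\<And>B. B \<in> A d ` \<F> \<Longrightarrow> AE x in M. x \<in> B \<longrightarrow> x \<in> V) \<Longrightarrow>
        AE x in M. x \<in> U \<longrightarrow> x \<in> V"
      by (rule Dedekind_ess_sup[OF assms(1) _ ne dir]) (use A in auto)
    have "AE x in M. x \<in> F \<longrightarrow> (x \<in> U \<longleftrightarrow> d < k F x)" if F: "F \<in> \<F>" for F
    proof -
      \<comment> \<open>This is the largest set meeting \<open>F\<close> only in
        \<open>A d F\<close>. It is an upper bound of the whole family, since \<open>k G\<close> and
        \<open>k F\<close> agree almost everywhere on the overlap; leastness of \<open>U\<close>
        then prevents \<open>U\<close> from being too large on \<open>F\<close>.\<close>
      let ?V = "space M - (F - A d F)"
      have "AE x in M. x \<in> A d G \<longrightarrow> x \<in> ?V" if G: "G \<in> \<F>" for G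
        using compat[OF F G] by eventually_elim (auto simp: A_def)
      then have "AE x in M. x \<in> U \<longrightarrow> x \<in> ?V"
        using sets[OF F] A[OF F] by (intro U(3)) auto
      moreover have "AE x in M. x \<in> A d F \<longrightarrow> x \<in> U"
        using F by (intro U(2)) auto
      ultimately show ?thesis
        using AE_space by eventually_elim (auto simp: A_def)
    qed
    then show ?thesis
      using U(1) by blast
  qed
  then have "\<forall>d. \<exists>U. U \<in> sets M \<and> (\<forall>F\<in>\<F>. AE x in M. x \<in> F \<longrightarrow> (x \<in> U \<longleftrightarrow> d < k F x))"
    by blast
  from choice[OF this] obtain U where
    U [measurable]: "\<And>d. U d \<in> sets M" and
    U_iff: "\<And>d F. F \<in> \<F> \<Longrightarrow> AE x in M. x \<in> F \<longrightarrow> (x \<in> U d \<longleftrightarrow> d < k F x)"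
    by blast
  \<comment> \<open>The relation between \<open>U d\<close> and \<open>k F\<close> holds outside a
    null set depending on \<open>d\<close>; a countable order-dense set of levels lets these null
    sets be united.\<close>
  obtain D :: "ennreal set" where D: "countable D" "\<And>x y. x < y \<Longrightarrow> \<exists>b\<in>D. x < b \<and> b < y"
    using countable_separating_set_dense_linorder by blast
  \<comment> \<open>Each value is recovered as the supremum of the levels in \<open>D\<close> below
    it. The exceptional null set still depends on \<open>F\<close>, which is harmless because the
    integrals are compared for one \<open>F\<close> at a time.\<close>
  define h where "h x = (SUP d\<in>D. d * indicator (U d) x)" for x
  have h [measurable]: "h \<in> borel_measurable M"
    unfolding h_def using D(1) by (intro borel_measurable_SUP) auto
  have "emeasure N F = (\<integral>\<^sup>+x\<in>F. h x \<partial>M)" if F: "F \<in> \<F>" for F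
  proof -
    have "AE x in M. \<forall>d\<in>D. x \<in> F \<longrightarrow> (x \<in> U d \<longleftrightarrow> d < k F x)"
      using U_iff[OF F] D(1) by (intro AE_ball_countable') auto
    then have "AE x in M. x \<in> F \<longrightarrow> k F x = h x"
    proof eventually_elim
      case (elim x)
      show ?case
      proof (intro impI antisym)
        assume x: "x \<in> F"
        show "k F x \<le> h x"
        proof (rule dense_le)
          fix y assume "y < k F x"
          then obtain d where d: "d \<in> D" "y < d" "d < k F x"
            using D(2) by blast
          then have "d * indicator (U d) x \<le> h x"
            unfolding h_def by (intro SUP_upper)
          moreover have "x \<in> U d"
            using elim x d by blast
          ultimately show "y \<le> h x"
            using d(2) by simp
        qed
        show "h x \<le> k F x"
          unfolding h_def
        proof (rule SUP_least)
          fix d assume "d \<in> D"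
          with elim x show "d * indicator (U d) x \<le> k F x"
            by (auto simp: indicator_def)
        qed
      qed
    qed
    then have "(\<integral>\<^sup>+x\<in>F. k F x \<partial>M) = (\<integral>\<^sup>+x\<in>F. h x \<partial>M)"
      by (intro nn_integral_cong_AE) (auto elim!: eventually_mono simp: indicator_def)
    then show ?thesis
      using k_eq[OF F sets[OF F]] by simp
  qed
  then show ?thesis
    using h by (auto simp: \<F>_def)
qed

text \<open>Both measures are cut down to \<open>S\<close>, as \<open>h\<close> is tied to
  \<open>N\<close> only on sets of finite measure. The cut of \<open>N\<close> is semifinite
  relative to \<open>M\<close> by hypothesis; the one with density \<open>h\<close> inherits this
  from \<open>M\<close> on \<open>S\<close> through \<open>semifinite_wrt_density\<close>.\<close>

lemma Dedekind_density_on_semifinite: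
  assumes "Dedekind M" "sets N = sets M" "absolutely_continuous M N"
    and "S \<in> sets M" "semifinite (restrict_space M S)"
    and "semifinite_wrt (restrict_space M S) (restrict_space N S)"
  shows "\<exists>h\<in>borel_measurable M. \<forall>E\<in>sets M. E \<subseteq> S \<longrightarrow> emeasure N E = (\<integral>\<^sup>+x\<in>E. h x \<partial>M)"
proof -
  obtain h where h [measurable]: "h \<in> borel_measurable M"
    and h_eq: "\<And>F. F \<in> sets M \<Longrightarrow> emeasure M F < \<infinity> \<Longrightarrow> emeasure N F = (\<integral>\<^sup>+x\<in>F. h x \<partial>M)"
    using Dedekind_density_on_finite[OF assms(1-3)] by blast
  let ?N = "density N (indicator S)" and ?N' = "density (density M (indicator S)) h"
  have eqN: "emeasure ?N E = emeasure N (S \<inter> E)" if "E \<in> sets M" for E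
    using that assms by (simp add: emeasure_density_indicator)
  have "?N = ?N'"
  proof (rule semifinite_wrt_eqI)
    show "semifinite_wrt M ?N"
      by (rule semifinite_wrt_density_indicator[OF assms(4,2,6)])
    have "semifinite_wrt M (density M (indicator S))"
      unfolding semifinite_wrt_def
    proof (intro ballI impI)
      fix E assume E: "E \<in> sets M" "0 < emeasure (density M (indicator S)) E"
      then have pos: "0 < emeasure M (S \<inter> E)" and meas: "S \<inter> E \<in> sets M"
        using assms(4) by (auto simp: emeasure_density_indicator)
      obtain F where F: "F \<in> sets M" "F \<subseteq> S \<inter> E" "0 < emeasure M F" "emeasure M F < \<infinity>"
        by (rule semifinite_restrict_spaceD[OF assms(5,4) meas Int_lower1 pos])
      moreover have "S \<inter> F = F" "F \<subseteq> E"
        using F(2) by auto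
      ultimately show "\<exists>F\<in>sets M. F \<subseteq> E \<and> emeasure M F < \<infinity> \<and> 0 < emeasure (density M (indicator S)) F"
        using assms(4) by (intro bexI[of _ F]) (simp_all add: emeasure_density_indicator)
    qed
    then show "semifinite_wrt M ?N'"
      by (rule semifinite_wrt_density) simp_all
    fix F assume F: "F \<in> sets M" "emeasure M F < \<infinity>"
    have "emeasure M (S \<inter> F) \<le> emeasure M F"
      using F by (intro emeasure_mono) auto
    also note F(2)
    finally show "emeasure ?N F = emeasure ?N' F"
      using h_eq[of "S \<inter> F"] F(1) assms(4) by (simp add: eqN emeasure_density_density_indicator)
  qed (use assms in simp_all)
  have "emeasure N E = (\<integral>\<^sup>+x\<in>E. h x \<partial>M)" if E: "E \<in> sets M" "E \<subseteq> S" for E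
  proof -
    have "S \<inter> E = E"
      using E(2) by blast
    then show ?thesis
      using eqN[OF E(1)] emeasure_density_density_indicator[OF assms(4) h E(1)] \<open>?N = ?N'\<close> by simp
  qed
  then show ?thesis
    using h by blast
qed

section \<open>Normality\<close>

text \<open>Take an increasing sequence along which the integrals approach their supremum: replacing its
  limit by the maximum with a further member does not increase the integral.\<close>

lemma directed_countable_domination:
  fixes p :: "'i \<Rightarrow> 'a \<Rightarrow> ennreal"
  assumes "I \<noteq> {}" "refl_on I r"
    and dir: "\<And>i j. i \<in> I \<Longrightarrow> j \<in> I \<Longrightarrow> \<exists>k\<in>I. (i, k) \<in> r \<and> (j, k) \<in> r"
    and meas [measurable]: "\<And>i. i \<in> I \<Longrightarrow> p i \<in> borel_measurable M"
    and mono: "\<And>i j. (i, j) \<in> r \<Longrightarrow> AE x in M. p i x \<le> p j x"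
    and fin: "(SUP i\<in>I. \<integral>\<^sup>+x. p i x \<partial>M) \<noteq> \<infinity>"
  obtains t :: "nat \<Rightarrow> 'i" where "\<And>n. t n \<in> I" "\<And>n. (t n, t (Suc n)) \<in> r"
    "\<And>i. i \<in> I \<Longrightarrow> AE x in M. p i x \<le> (SUP n. p (t n) x)"
proof -
  let ?\<alpha> = "SUP i\<in>I. \<integral>\<^sup>+x. p i x \<partial>M"
  obtain a where a: "range a \<subseteq> (\<lambda>i. \<integral>\<^sup>+x. p i x \<partial>M) ` I" "?\<alpha> = (SUP n::nat. a n)"
    using ennreal_SUP_countable_SUP[OF assms(1), of "\<lambda>i. \<integral>\<^sup>+x. p i x \<partial>M"] by auto
  then have "\<forall>n. \<exists>i. i \<in> I \<and> a n = (\<integral>\<^sup>+x. p i x \<partial>M)"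
    by blast
  from choice[OF this] obtain u where u: "\<And>n. u n \<in> I" "\<And>n. a n = (\<integral>\<^sup>+x. p (u n) x \<partial>M)"
    by blast
  have "\<forall>z. \<exists>k. z \<in> I \<times> I \<longrightarrow> k \<in> I \<and> (fst z, k) \<in> r \<and> (snd z, k) \<in> r"
    using dir by force
  from choice[OF this] obtain up where
    up: "\<And>i j. i \<in> I \<Longrightarrow> j \<in> I \<Longrightarrow> up (i, j) \<in> I \<and> (i, up (i, j)) \<in> r \<and> (j, up (i, j)) \<in> r"
    by force
  \<comment> \<open>Only the integrals along \<open>u\<close> approach the supremum;
    \<open>u\<close> need not be increasing in \<open>r\<close>. Each \<open>t (Suc n)\<close> is
    chosen above both \<open>t n\<close> and \<open>u (Suc n)\<close>, so \<open>t\<close> increases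
    and dominates \<open>u\<close>.\<close>
  define t where "t = rec_nat (u 0) (\<lambda>n i. up (i, u (Suc n)))"
  have t_Suc: "t (Suc n) = up (t n, u (Suc n))" and t_0: "t 0 = u 0" for n
    by (simp_all add: t_def)
  have t [measurable]: "t n \<in> I" for n
    by (induction n) (use u up in \<open>auto simp: t_Suc t_0\<close>)
  have inc: "(t n, t (Suc n)) \<in> r" for n
    using up[OF t u(1)] by (simp add: t_Suc)
  have ut: "(u n, t n) \<in> r" for n
  proof (cases n)
    case 0
    then show ?thesis
      using assms(2) u(1) by (simp add: t_0 refl_on_def)
  next
    case (Suc m)
    then show ?thesis
      using up[OF t u(1)] by (simp add: t_Suc)
  qed
  define g where "g x = (SUP n. p (t n) x)" for x
  have meas_t [measurable]: "p (t n) \<in> borel_measurable M" for n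
    using meas t by blast
  have g [measurable]: "g \<in> borel_measurable M"
    unfolding g_def by measurable
  have le: "(\<integral>\<^sup>+x. p i x \<partial>M) \<le> ?\<alpha>" if "i \<in> I" for i
    using that by (rule SUP_upper)
  have int_g: "(\<integral>\<^sup>+x. g x \<partial>M) = ?\<alpha>"
  proof (rule antisym)
    have "(\<integral>\<^sup>+x. g x \<partial>M) = (SUP n. \<integral>\<^sup>+x. p (t n) x \<partial>M)"
      unfolding g_def by (intro nn_integral_monotone_convergence_SUP_AE mono inc meas_t)
    also have "\<dots> \<le> ?\<alpha>"
      using le t by (intro SUP_least) blast
    finally show "(\<integral>\<^sup>+x. g x \<partial>M) \<le> ?\<alpha>" .
    show "?\<alpha> \<le> (\<integral>\<^sup>+x. g x \<partial>M)"
      unfolding a(2) u(2)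
    proof (intro SUP_least nn_integral_mono_AE)
      fix n show "AE x in M. p (u n) x \<le> g x"
        using mono[OF ut[of n]]
      proof eventually_elim
        case (elim x)
        also have "p (t n) x \<le> g x"
          unfolding g_def by (rule SUP_upper) simp
        finally show ?case .
      qed
    qed
  qed
  have fin_g: "(\<integral>\<^sup>+x. g x \<partial>M) < top_class.top"
    using fin unfolding int_g infinity_ennreal_def less_top .
  have "AE x in M. p i x \<le> g x" if i: "i \<in> I" for i
  proof -
    have [measurable]: "p i \<in> borel_measurable M"
      using meas i by blast
    have "(\<integral>\<^sup>+x. (SUP n. max (p i x) (p (t n) x)) \<partial>M) = (SUP n. \<integral>\<^sup>+x. max (p i x) (p (t n) x) \<partial>M)"
    proof (intro nn_integral_monotone_convergence_SUP_AE)
      fix n show "AE x in M. max (p i x) (p (t n) x) \<le> max (p i x) (p (t (Suc n)) x)"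
        using mono[OF inc[of n]] by eventually_elim (auto simp: max_def)
    qed measurable
    also have "\<dots> \<le> ?\<alpha>"
    proof (rule SUP_least)
      fix n
      have up: "up (i, t n) \<in> I" "(i, up (i, t n)) \<in> r" "(t n, up (i, t n)) \<in> r"
        using up[OF i t] by auto
      \<comment> \<open>The maximum of two members lies below a third one, so its integral cannot
        exceed \<open>?\<alpha>\<close>.\<close>
      have "(\<integral>\<^sup>+x. max (p i x) (p (t n) x) \<partial>M) \<le> (\<integral>\<^sup>+x. p (up (i, t n)) x \<partial>M)"
      proof (rule nn_integral_mono_AE)
        show "AE x in M. max (p i x) (p (t n) x) \<le> p (up (i, t n)) x"
          using mono[OF up(2)] mono[OF up(3)] by eventually_elim simp
      qed
      also have "\<dots> \<le> ?\<alpha>"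
        by (rule le[OF up(1)])
      finally show "(\<integral>\<^sup>+x. max (p i x) (p (t n) x) \<partial>M) \<le> ?\<alpha>" .
    qed
    also have "(\<lambda>x. SUP n. max (p i x) (p (t n) x)) = (\<lambda>x. max (p i x) (g x))"
    proof
      fix x
      show "(SUP n. max (p i x) (p (t n) x)) = max (p i x) (g x)"
        unfolding g_def by (simp flip: sup_max add: SUP_sup_distrib[symmetric])
    qed
    finally have le_g: "(\<integral>\<^sup>+x. max (p i x) (g x) \<partial>M) \<le> (\<integral>\<^sup>+x. g x \<partial>M)"
      using int_g by simp
    \<comment> \<open>Finiteness of the supremum enters here: the integral of \<open>g\<close> may
      be subtracted, and a nonnegative difference with integral 0 vanishes almost
      everywhere.\<close>
    have "(\<integral>\<^sup>+x. max (p i x) (g x) - g x \<partial>M) = (\<integral>\<^sup>+x. max (p i x) (g x) \<partial>M) - (\<integral>\<^sup>+x. g x \<partial>M)"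
      using fin int_g by (intro nn_integral_diff) auto
    also have "\<dots> = 0"
      by (rule diff_eq_0_ennreal[OF le_less_trans[OF le_g fin_g] le_g])
    finally have "AE x in M. max (p i x) (g x) - g x = 0"
      by (subst (asm) nn_integral_0_iff_AE) simp_all
    then show ?thesis
    proof eventually_elim
      case (elim x)
      then show ?case
        by (auto simp: max_def ennreal_minus_eq_0 split: if_splits)
    qed
  qed
  then show thesis
    using that[of t] t inc by (simp add: g_def)
qed

text \<open>A net and its supremum in \<open>Linfty_pos\<close>, read on representatives. The clause
  \<open>least\<close> tests only against essentially bounded nonnegative functions, as the carrier
  contains no others; an arbitrary pointwise bound must therefore be brought into that form
  first.\<close>

locale Linfty_net_sup =
  fixes M :: "'a measure" and I :: "'i set" and r :: "'i rel"
    and f :: "'i \<Rightarrow> 'a \<Rightarrow> complex" and g :: "'a \<Rightarrow> complex"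
  assumes nonempty: "I \<noteq> {}" and reflexive: "refl_on I r"
    and dir: "\<And>i j. i \<in> I \<Longrightarrow> j \<in> I \<Longrightarrow> \<exists>k\<in>I. (i, k) \<in> r \<and> (j, k) \<in> r"
    and f: "\<And>i. i \<in> I \<Longrightarrow> f i \<in> ess_bounded M"
    and mono: "\<And>i j. (i, j) \<in> r \<Longrightarrow> AE x in M. f i x \<le> f j x"
    and g: "g \<in> ess_bounded M" and g_nonneg: "AE x in M. 0 \<le> g x"
    and upper: "\<And>i. i \<in> I \<Longrightarrow> AE x in M. f i x \<le> g x"
    and least: "\<And>u. u \<in> ess_bounded M \<Longrightarrow> AE x in M. 0 \<le> u x \<Longrightarrow>
      (\<And>i. i \<in> I \<Longrightarrow> AE x in M. f i x \<le> u x) \<Longrightarrow> AE x in M. g x \<le> u x"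
begin

abbreviation p where "p i x \<equiv> ennreal (Re (f i x))"
abbreviation q where "q x \<equiv> ennreal (Re (g x))"

lemma meas [measurable]: "i \<in> I \<Longrightarrow> f i \<in> borel_measurable M" "g \<in> borel_measurable M"
  using f g by (auto dest: ess_bounded_measurable)

lemma p_le_q: "i \<in> I \<Longrightarrow> AE x in M. p i x \<le> q x"
  using upper[of i] by (auto elim!: eventually_mono simp: less_eq_complex_def intro: ennreal_leI)

lemma p_mono: "(i, j) \<in> r \<Longrightarrow> AE x in M. p i x \<le> p j x"
  using mono[of i j] by (auto elim!: eventually_mono simp: less_eq_complex_def intro: ennreal_leI)

text \<open>Truncating the supremum at \<open>k\<close> on \<open>F\<close> leaves an upper bound.\<close>

lemma sup_le_on:
  assumes [measurable]: "F \<in> sets M" "k \<in> borel_measurable M"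
    and k: "\<And>i. i \<in> I \<Longrightarrow> AE x in M. x \<in> F \<longrightarrow> p i x \<le> k x"
  shows "AE x in M. x \<in> F \<longrightarrow> q x \<le> k x"
proof -
  \<comment> \<open>Where \<open>g\<close> is replaced, \<open>k\<close> lies below \<open>q\<close>
    and is therefore finite, so \<open>enn2real\<close> loses nothing. Keeping \<open>g\<close>
    elsewhere makes \<open>u\<close> essentially bounded even if \<open>k\<close> is unbounded or
    infinite.\<close>
  define u where "u x = (if x \<in> F \<and> k x < q x then complex_of_real (enn2real (k x)) else g x)" for x
  have u_real: "u x = complex_of_real (enn2real (k x))" "enn2real (k x) < Re (g x)"
      "k x = ennreal (enn2real (k x))"
    if "x \<in> F" "k x < q x" for x
  proof -
    have "k x < \<infinity>"
      using that(2) by (metis ennreal_less_top infinity_ennreal_def order.strict_trans)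
    then show "k x = ennreal (enn2real (k x))"
      by simp
    then show "enn2real (k x) < Re (g x)"
      using that(2) by (metis enn2real_nonneg ennreal_less_iff)
  qed (use that in \<open>simp add: u_def\<close>)
  have "u \<in> ess_bounded M"
  proof -
    obtain C where "AE x in M. norm (g x) \<le> C"
      using g by (auto simp: ess_bounded_def)
    then have "AE x in M. norm (u x) \<le> C"
    proof eventually_elim
      case (elim x)
      show ?case
      proof (cases "x \<in> F \<and> k x < q x")
        case True
        then have "norm (u x) \<le> Re (g x)"
          using u_real[of x] by simp
        with elim show ?thesis
          using complex_Re_le_cmod[of "g x"] by linarith
      next
        case False
        then have "u x = g x"
          by (auto simp: u_def)
        with elim show ?thesis
          by simp
      qed
    qed
    moreover have "u \<in> borel_measurable M"
      unfolding u_def by measurable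
    ultimately show ?thesis
      by (rule ess_boundedI[rotated])
  qed
  moreover have "AE x in M. 0 \<le> u x"
    using g_nonneg by eventually_elim (auto simp: u_def less_eq_complex_def)
  \<comment> \<open>The order on complex numbers also requires equal imaginary parts:
    \<open>upper\<close> and \<open>g_nonneg\<close> force that of \<open>f i x\<close> to
    vanish.\<close>
  moreover have "AE x in M. f i x \<le> u x" if "i \<in> I" for i
    using upper[OF that] k[OF that] g_nonneg
  proof eventually_elim
    case (elim x)
    show ?case
    proof (cases "x \<in> F \<and> k x < q x")
      case True
      then have "p i x \<le> ennreal (enn2real (k x))"
        using elim(2) u_real(3)[of x] by simp
      then have "Re (f i x) \<le> enn2real (k x)"
        by (simp add: ennreal_le_iff2) (use enn2real_nonneg[of "k x"] in linarith)
      then show ?thesis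
        using True elim by (simp add: u_def less_eq_complex_def)
    next
      case False
      then have "u x = g x"
        by (auto simp: u_def)
      with elim show ?thesis
        by simp
    qed
  qed
  ultimately have "AE x in M. g x \<le> u x"
    by (rule least)
  then show ?thesis
  proof eventually_elim
    case (elim x)
    show ?case
    proof (intro impI leI notI)
      assume "x \<in> F" "k x < q x"
      with u_real[of x] elim show False
        by (simp add: less_eq_complex_def)
    qed
  qed
qed

text \<open>The integrals over \<open>F\<close> with respect to \<open>N\<close> may be infinite, so
  \<open>directed_countable_domination\<close> is applied to \<open>M\<close> cut down to
  \<open>F\<close>, where they are at most \<open>C\<close> times the measure of \<open>F\<close>.
  The resulting sequence has the supremum \<open>q\<close> as a lower bound of its limit on
  \<open>F\<close>; absolute continuity carries this to \<open>N\<close>, where monotone convergence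
  applies.\<close>

lemma set_integral_le_SUP:
  assumes N: "sets N = sets M" "absolutely_continuous M N"
    and F [measurable]: "F \<in> sets M" and fin: "emeasure M F < \<infinity>"
  shows "(\<integral>\<^sup>+x\<in>F. q x \<partial>N) \<le> (SUP i\<in>I. \<integral>\<^sup>+x. p i x \<partial>N)"
proof -
  let ?K = "density M (indicator F)"
  have AE_K: "AE x in ?K. P x" if "AE x in M. P x" for P
    using that by (auto simp: AE_density_indicator elim: eventually_mono)
  obtain C where C: "AE x in M. norm (g x) \<le> C"
    using g by (auto simp: ess_bounded_def)
  have "(SUP i\<in>I. \<integral>\<^sup>+x. p i x \<partial>?K) \<le> ennreal C * emeasure M F"
  proof (rule SUP_least)
    fix i assume i: "i \<in> I"
    have "AE x in M. p i x \<le> ennreal C"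
      using upper[OF i] C
    proof eventually_elim
      case (elim x)
      then show ?case
        using complex_Re_le_cmod[of "g x"] by (intro ennreal_leI) (simp add: less_eq_complex_def)
    qed
    then have "(\<integral>\<^sup>+x. p i x \<partial>?K) \<le> (\<integral>\<^sup>+x. ennreal C \<partial>?K)"
      by (intro nn_integral_mono_AE AE_K)
    also have "\<dots> = ennreal C * emeasure M F"
      by (simp add: emeasure_density_indicator)
    finally show "(\<integral>\<^sup>+x. p i x \<partial>?K) \<le> ennreal C * emeasure M F" .
  qed
  also have "\<dots> < \<infinity>"
    using fin by (simp add: ennreal_mult_less_top)
  finally have fin': "(SUP i\<in>I. \<integral>\<^sup>+x. p i x \<partial>?K) \<noteq> \<infinity>"
    by (rule less_imp_neq)
  have measK: "p i \<in> borel_measurable ?K" if "i \<in> I" for i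
    using meas(1)[OF that] by simp
  obtain t :: "nat \<Rightarrow> 'i" where t: "\<And>n. t n \<in> I" "\<And>n. (t n, t (Suc n)) \<in> r"
    "\<And>i. i \<in> I \<Longrightarrow> AE x in ?K. p i x \<le> (SUP n. p (t n) x)"
    using directed_countable_domination[OF nonempty reflexive dir measK AE_K[OF p_mono] fin'] by blast
  have mt [measurable]: "f (t n) \<in> borel_measurable M" for n
    using meas(1) t(1) by blast
  have "AE x in M. x \<in> F \<longrightarrow> q x \<le> (SUP n. p (t n) x)"
    by (rule sup_le_on) (use t(3) in \<open>simp_all add: AE_density_indicator\<close>)
  then have "AE x in N. x \<in> F \<longrightarrow> q x \<le> (SUP n. p (t n) x)"
    by (rule absolutely_continuous_AE[OF N])
  then have "(\<integral>\<^sup>+x\<in>F. q x \<partial>N) \<le> (\<integral>\<^sup>+x. (SUP n. p (t n) x) \<partial>N)"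
    by (intro nn_integral_mono_AE) (auto elim!: eventually_mono simp: indicator_def)
  also have "\<dots> = (SUP n. \<integral>\<^sup>+x. p (t n) x \<partial>N)"
  proof (rule nn_integral_monotone_convergence_SUP_AE)
    show "AE x in N. p (t n) x \<le> p (t (Suc n)) x" for n
      by (rule absolutely_continuous_AE[OF N p_mono[OF t(2)]])
    show "p (t n) \<in> borel_measurable N" for n
      using mt[of n] by (simp add: measurable_cong_sets[OF N(1) refl])
  qed
  also have "\<dots> \<le> (SUP i\<in>I. \<integral>\<^sup>+x. p i x \<partial>N)"
    by (intro SUP_least SUP_upper t(1))
  finally show ?thesis .
qed

text \<open>If \<open>q\<close> vanishes \<open>N\<close>-almost everywhere off \<open>S\<close>,
  the measure with density \<open>q\<close> lives on \<open>S\<close> and is determined by sets of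
  finite \<open>M\<close>-measure, handled by \<open>set_integral_le_SUP\<close>. Otherwise
  \<open>N\<close> is infinite on every non-null set off \<open>S\<close>, and a single member of
  the net already has integral \<infinity>.\<close>

lemma integral_SUP:
  assumes N: "sets N = sets M" "absolutely_continuous M N" and S: "S \<in> sets M"
    and semi: "semifinite_wrt M (density N (indicator S))"
    and off: "emeasure N (space M - S) = 0 \<or> infinite_off M N S"
  shows "(\<integral>\<^sup>+x. q x \<partial>N) = (SUP i\<in>I. \<integral>\<^sup>+x. p i x \<partial>N)"
proof (rule antisym)
  show "(SUP i\<in>I. \<integral>\<^sup>+x. p i x \<partial>N) \<le> (\<integral>\<^sup>+x. q x \<partial>N)"
    by (intro SUP_least nn_integral_mono_AE absolutely_continuous_AE[OF N p_le_q])
  have [simp]: "space N = space M"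
    using N(1) by (rule sets_eq_imp_space_eq)
  have measN: "borel_measurable N = borel_measurable M"
    by (rule measurable_cong_sets[OF N(1) refl])
  have [measurable]: "S \<in> sets M" "S \<in> sets N" "q \<in> borel_measurable N"
    using S N(1) by (auto simp: measN)
  show "(\<integral>\<^sup>+x. q x \<partial>N) \<le> (SUP i\<in>I. \<integral>\<^sup>+x. p i x \<partial>N)"
  proof (cases "AE x in N. x \<in> space M - S \<longrightarrow> q x \<le> 0")
    case True
    let ?Q = "density (density N (indicator S)) q"
    have Q: "emeasure ?Q E = (\<integral>\<^sup>+x\<in>S \<inter> E. q x \<partial>N)" if "E \<in> sets M" for E
      using that N(1) by (intro emeasure_density_density_indicator) auto
    have "(\<integral>\<^sup>+x. q x \<partial>N) = (\<integral>\<^sup>+x\<in>S \<inter> space M. q x \<partial>N)"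
    proof (rule nn_integral_cong_AE)
      show "AE x in N. q x = q x * indicator (S \<inter> space M) x"
        using True AE_space by eventually_elim (auto simp: indicator_def)
    qed
    also have "\<dots> = emeasure ?Q (space M)"
      by (simp add: Q)
    also have "\<dots> = (SUP F\<in>{F \<in> sets M. F \<subseteq> space M \<and> emeasure M F < \<infinity>}. emeasure ?Q F)"
    proof (rule semifinite_wrt_emeasure_eq_SUP)
      show "semifinite_wrt M ?Q"
        by (rule semifinite_wrt_density[OF semi]) (simp_all add: N(1))
    qed (simp_all add: N(1))
    also have "\<dots> \<le> (SUP i\<in>I. \<integral>\<^sup>+x. p i x \<partial>N)"
    proof (rule SUP_least)
      fix F assume "F \<in> {F \<in> sets M. F \<subseteq> space M \<and> emeasure M F < \<infinity>}"
      then have F: "F \<in> sets M" "emeasure M F < \<infinity>"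
        by auto
      have "emeasure M (S \<inter> F) \<le> emeasure M F"
        using F by (intro emeasure_mono) auto
      also note F(2)
      finally show "emeasure ?Q F \<le> (SUP i\<in>I. \<integral>\<^sup>+x. p i x \<partial>N)"
        unfolding Q[OF F(1)] using F(1) by (intro set_integral_le_SUP[OF N]) auto
    qed
    finally show ?thesis .
  next
    case False
    have "emeasure N (space M - S) \<noteq> 0"
    proof
      assume "emeasure N (space M - S) = 0"
      then have "AE x in N. x \<notin> space M - S"
        using N(1) by (intro AE_not_in) (auto simp: null_sets_def)
      then have "AE x in N. x \<in> space M - S \<longrightarrow> q x \<le> 0"
        by eventually_elim blast
      with False show False
        by blast
    qed
    with off have inf: "emeasure N E = \<infinity>" if "E \<in> sets M" "E \<subseteq> space M - S" "0 < emeasure M E" for E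
      using that unfolding infinite_off_def by blast
    \<comment> \<open>If every member vanished off \<open>S\<close>, then so would the supremum, by
      \<open>sup_le_on\<close> with the bound 0.\<close>
    have "\<exists>i\<in>I. \<not> (AE x in M. x \<in> space M - S \<longrightarrow> p i x \<le> 0)"
    proof (rule ccontr)
      assume "\<not> ?thesis"
      then have "AE x in M. x \<in> space M - S \<longrightarrow> p j x \<le> 0" if "j \<in> I" for j
        using that by blast
      then have "AE x in M. x \<in> space M - S \<longrightarrow> q x \<le> 0"
        using sup_le_on[of "space M - S" "\<lambda>_. 0"] by simp
      then show False
        using False absolutely_continuous_AE[OF N] by blast
    qed
    then obtain i where i: "i \<in> I" "\<not> (AE x in M. x \<in> space M - S \<longrightarrow> p i x \<le> 0)"
      by blast
    note [measurable] = meas(1)[OF i(1)]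
    obtain D :: "ennreal set" where D: "countable D" "\<And>x y. x < y \<Longrightarrow> \<exists>b\<in>D. x < b \<and> b < y"
      using countable_separating_set_dense_linorder by blast
    \<comment> \<open>Not vanishing is not enough for an infinite integral; a positive lower bound
      on a non-null set is wanted. If every positive level failed, the countably many levels in
      \<open>D\<close> would already force \<open>p i\<close> to vanish off
      \<open>S\<close>.\<close>
    have "\<exists>b>0. \<not> (AE x in M. x \<in> space M - S \<longrightarrow> p i x \<le> b)"
    proof (rule ccontr)
      assume "\<not> ?thesis"
      then have "AE x in M. \<forall>b\<in>{b \<in> D. b > 0}. x \<in> space M - S \<longrightarrow> p i x \<le> b"
        using D(1) by (intro AE_ball_countable') (blast, simp)
      then have "AE x in M. x \<in> space M - S \<longrightarrow> p i x \<le> 0"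
      proof eventually_elim
        case (elim x)
        show ?case
        proof (intro impI leI notI)
          assume x: "x \<in> space M - S" "0 < p i x"
          from D(2)[OF x(2)] obtain b where "b \<in> D" "0 < b" "b < p i x"
            by blast
          with elim x show False
            by (metis (no_types, lifting) leD mem_Collect_eq)
        qed
      qed
      with i(2) show False
        by blast
    qed
    then obtain b where b: "b > 0" "\<not> (AE x in M. x \<in> space M - S \<longrightarrow> p i x \<le> b)"
      by blast
    let ?E = "{x \<in> space M. x \<notin> S \<and> b < p i x}"
    have E [measurable]: "?E \<in> sets M"
      by measurable
    have "emeasure M ?E \<noteq> 0"
    proof
      assume "emeasure M ?E = 0"
      then have "AE x in M. x \<notin> ?E"
        by (intro AE_not_in) (auto simp: null_sets_def)
      then have "AE x in M. x \<in> space M - S \<longrightarrow> p i x \<le> b"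
        by eventually_elim (auto simp: not_less)
      with b(2) show False
        by blast
    qed
    then have "emeasure N ?E = \<infinity>"
      by (intro inf E) (auto simp: zero_less_iff_neq_zero)
    then have "\<infinity> = b * emeasure N ?E"
      using b(1) by (simp add: ennreal_mult_top)
    also have "\<dots> = (\<integral>\<^sup>+x. b * indicator ?E x \<partial>N)"
      using E N(1) by (simp add: nn_integral_cmult_indicator)
    also have "\<dots> \<le> (\<integral>\<^sup>+x. p i x \<partial>N)"
      by (intro nn_integral_mono) (auto simp: indicator_def)
    also have "\<dots> \<le> (SUP i\<in>I. \<integral>\<^sup>+x. p i x \<partial>N)"
      using i(1) by (rule SUP_upper)
    finally show ?thesis
      by (rule order_trans[rotated]) simp
  qed
qed

end

section \<open>Normality: from classes to representatives\<close>

lemma Linfty_net_sup_representatives: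
  assumes net: "increasing_net (Linfty_pos M) I r x" and sup: "is_net_sup (Linfty_pos M) I x s"
  obtains f g where "Linfty_net_sup M I r f g" "\<And>i. i \<in> I \<Longrightarrow> x i = ess_class M (f i)"
    "s = ess_class M g"
proof -
  let ?L = "Linfty_pos M"
  have le: "le ?L = Linfty_le M"
    by (simp add: Linfty_pos_def)
  from net have net': "I \<noteq> {}" "preorder_on I r" "\<forall>i\<in>I. \<forall>j\<in>I. \<exists>k\<in>I. (i, k) \<in> r \<and> (j, k) \<in> r"
    "x \<in> I \<rightarrow> carrier ?L" "\<forall>(i, j)\<in>r. Linfty_le M (x i) (x j)"
    unfolding increasing_net_def le by blast+
  have r: "r \<subseteq> I \<times> I" "refl_on I r"
    using net'(2) by (auto simp: preorder_on_def)
  have "\<forall>i\<in>I. \<exists>f. f \<in> ess_bounded M \<and> x i = ess_class M f"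
    using net'(4) unfolding Pi_iff Linfty_pos_carrier_iff by blast
  from bchoice[OF this] obtain f where
    f: "\<And>i. i \<in> I \<Longrightarrow> f i \<in> ess_bounded M" "\<And>i. i \<in> I \<Longrightarrow> x i = ess_class M (f i)"
    by blast
  from sup have s: "s \<in> Upper ?L (x ` I)" "\<And>u. u \<in> Upper ?L (x ` I) \<Longrightarrow> Linfty_le M s u"
    unfolding is_net_sup_def least_def le by blast+
  have Upper_iff: "u \<in> Upper ?L (x ` I) \<longleftrightarrow> u \<in> carrier ?L \<and> (\<forall>i\<in>I. Linfty_le M (x i) u)" for u
    using net'(4) unfolding Upper_def le by blast
  obtain g where g: "g \<in> ess_bounded M" "s = ess_class M g" "AE x in M. 0 \<le> g x"
    using s(1) unfolding Upper_iff Linfty_pos_carrier_iff by blast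
  have "Linfty_net_sup M I r f g"
  proof
    show "\<exists>k\<in>I. (i, k) \<in> r \<and> (j, k) \<in> r" if "i \<in> I" "j \<in> I" for i j
      using net'(3) that by blast
    show "AE y in M. f i y \<le> f j y" if "(i, j) \<in> r" for i j
    proof -
      have ij: "i \<in> I" "j \<in> I"
        using that r(1) by auto
      moreover have "Linfty_le M (x i) (x j)"
        using that net'(5) by blast
      ultimately show ?thesis
        using f by (simp add: Linfty_le_ess_class_iff)
    qed
    show "AE y in M. f i y \<le> g y" if "i \<in> I" for i
    proof -
      have "Linfty_le M (x i) s"
        using that s(1) unfolding Upper_iff by blast
      then show ?thesis
        using that f g by (simp add: Linfty_le_ess_class_iff)
    qed
    show "AE y in M. g y \<le> u y" if u: "u \<in> ess_bounded M" "AE y in M. 0 \<le> u y"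
      and ub: "\<And>i. i \<in> I \<Longrightarrow> AE y in M. f i y \<le> u y" for u
    proof -
      have "ess_class M u \<in> carrier ?L"
        using u unfolding Linfty_pos_carrier_iff by blast
      moreover have "Linfty_le M (x i) (ess_class M u)" if "i \<in> I" for i
        using ub[OF that] f[OF that] u(1) by (simp add: Linfty_le_ess_class_iff)
      ultimately have "Linfty_le M s (ess_class M u)"
        by (intro s(2)) (simp add: Upper_iff)
      then show ?thesis
        using g u(1) by (simp add: Linfty_le_ess_class_iff)
    qed
  qed (use net'(1) r(2) f(1) g(1,3) in simp_all)
  then show thesis
    using that f(2) g(2) by blast
qed

lemma normal_integral_functional:
  assumes "sets N = sets M" "absolutely_continuous M N" "S \<in> sets M"
    and "semifinite_wrt M (density N (indicator S))"
    and "emeasure N (space M - S) = 0 \<or> infinite_off M N S"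
  shows "normal_functional TYPE('i) M (integral_functional N)"
  unfolding normal_functional_def
proof (intro allI impI, elim conjE)
  fix I :: "'i set" and r x s
  assume "increasing_net (Linfty_pos M) I r x" "is_net_sup (Linfty_pos M) I x s"
  then obtain f g where fg: "Linfty_net_sup M I r f g" "\<And>i. i \<in> I \<Longrightarrow> x i = ess_class M (f i)"
    "s = ess_class M g"
    by (rule Linfty_net_sup_representatives) blast
  interpret Linfty_net_sup M I r f g
    by (rule fg(1))
  show "integral_functional N s = (SUP i\<in>I. integral_functional N (x i))"
    using integral_SUP[OF assms] f g
    by (simp add: fg(2,3) integral_functional_ess_class[OF assms(1,2)])
qed

section \<open>Densities on the whole space\<close>

lemma is_density_cong_AE:
  assumes "is_density M N h" "h' \<in> borel_measurable M" "AE x in M. h x = h' x"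
  shows "is_density M N h'"
proof -
  have "(\<integral>\<^sup>+x\<in>E. h x \<partial>M) = (\<integral>\<^sup>+x\<in>E. h' x \<partial>M)" for E
    using assms(3) by (rule nn_set_integral_cong)
  then show ?thesis
    using assms by (simp add: is_density_def)
qed

text \<open>Reduces (i) and (ii) to a common form. Off \<open>S\<close> the measure \<open>M\<close>
  takes only the values 0 and \<infinity>, so a finite set witnessing positivity of \<open>N\<close>
  there would be \<open>M\<close>-null and hence \<open>N\<close>-null; under (i) this leaves
  \<open>N\<close> zero off \<open>S\<close>.\<close>

lemma semifinite_part_cases:
  assumes "sets N = sets M" "absolutely_continuous M N" "semifinite_part M S"
    and "semifinite_wrt M N \<or>
      (semifinite_wrt (restrict_space M S) (restrict_space N S) \<and> infinite_off M N S)"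
  shows "semifinite_wrt (restrict_space M S) (restrict_space N S)"
    and "emeasure N (space M - S) = 0 \<or> infinite_off M N S"
proof -
  have S: "S \<in> sets M"
    and inf: "\<And>E. E \<in> sets M \<Longrightarrow> E \<subseteq> space M - S \<Longrightarrow> 0 < emeasure M E \<Longrightarrow> emeasure M E = \<infinity>"
    using assms(3) by (auto simp: semifinite_part_def)
  show "semifinite_wrt (restrict_space M S) (restrict_space N S)"
    using assms(4)
  proof (elim disjE conjE)
    assume "semifinite_wrt M N"
    then show ?thesis
      unfolding semifinite_wrt_restrict_space_iff[OF S assms(1)] by (simp add: semifinite_wrt_def)
  qed
  show "emeasure N (space M - S) = 0 \<or> infinite_off M N S"
  proof (rule disjCI)
    assume "\<not> infinite_off M N S"
    then have N: "semifinite_wrt M N"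
      using assms(4) by blast
    show "emeasure N (space M - S) = 0"
    proof (rule ccontr)
      assume "emeasure N (space M - S) \<noteq> 0"
      then have "0 < emeasure N (space M - S)"
        by (simp add: zero_less_iff_neq_zero)
      moreover have "space M - S \<in> sets M"
        using S by simp
      ultimately obtain F where F: "F \<in> sets M" "F \<subseteq> space M - S" "emeasure M F < \<infinity>" "0 < emeasure N F"
        using semifinite_wrtD[OF N] by metis
      then have "emeasure M F = 0"
        using inf[OF F(1,2)] F(3) by (metis less_irrefl zero_less_iff_neq_zero)
      then have "emeasure N F = 0"
        by (rule absolutely_continuousD[OF assms(2) F(1)])
      with F(4) show False
        by simp
    qed
  qed
qed

lemma is_density_exists:
  assumes ded: "Dedekind M" and N: "sets N = sets M" "absolutely_continuous M N"
    and part: "semifinite_part M S"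
    and semi: "semifinite_wrt (restrict_space M S) (restrict_space N S)"
    and off: "emeasure N (space M - S) = 0 \<or> infinite_off M N S"
  shows "\<exists>h. is_density M N h"
proof -
  have S [measurable]: "S \<in> sets M" and sfin: "semifinite (restrict_space M S)"
    using part by (auto simp: semifinite_part_def)
  obtain h where h [measurable]: "h \<in> borel_measurable M"
    and h_eq: "\<And>E. E \<in> sets M \<Longrightarrow> E \<subseteq> S \<Longrightarrow> emeasure N E = (\<integral>\<^sup>+x\<in>E. h x \<partial>M)"
    using Dedekind_density_on_semifinite[OF ded N S sfin semi] by blast
  \<comment> \<open>The conventions for products matter: 0 times \<infinity> is 0 where
    \<open>N\<close> vanishes off \<open>S\<close>, and \<infinity> times 0 is 0 on null sets in the
    other case.\<close>
  define c :: ennreal where "c = (if emeasure N (space M - S) = 0 then 0 else \<infinity>)"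
  have c: "emeasure N E = c * emeasure M E" if E: "E \<in> sets M" "E \<subseteq> space M - S" for E
  proof (cases "emeasure N (space M - S) = 0")
    case True
    have "emeasure N E \<le> emeasure N (space M - S)"
      using E(2) S N(1) by (intro emeasure_mono) auto
    with True show ?thesis
      by (simp add: c_def)
  next
    case False
    with off have inf: "infinite_off M N S"
      by blast
    show ?thesis
    proof (cases "emeasure M E = 0")
      case True
      then show ?thesis
        using absolutely_continuousD[OF N(2) E(1)] by simp
    next
      case pos: False
      then have "emeasure N E = \<infinity>"
        using inf E by (simp add: infinite_off_def zero_less_iff_neq_zero)
      with False pos show ?thesis
        by (simp add: c_def ennreal_top_mult)
    qed
  qed
  have "is_density M N (\<lambda>x. if x \<in> S then h x else c)"
    unfolding is_density_def
  proof (intro conjI ballI)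
    show "(\<lambda>x. if x \<in> S then h x else c) \<in> borel_measurable M"
      by measurable
    fix E assume E [measurable]: "E \<in> sets M"
    have "emeasure N E = emeasure N (E \<inter> S) + emeasure N (E - S)"
      using E S N(1) by (subst plus_emeasure) (auto simp: Int_Diff_Un)
    also have "emeasure N (E \<inter> S) = (\<integral>\<^sup>+x\<in>E \<inter> S. h x \<partial>M)"
      by (rule h_eq) auto
    also have "emeasure N (E - S) = c * emeasure M (E - S)"
      using sets.sets_into_space[OF E] by (intro c) auto
    also have "\<dots> = (\<integral>\<^sup>+x. c * indicator (E - S) x \<partial>M)"
      by (simp add: nn_integral_cmult_indicator)
    also have "(\<integral>\<^sup>+x\<in>E \<inter> S. h x \<partial>M) + \<dots> = (\<integral>\<^sup>+x. h x * indicator (E \<inter> S) x + c * indicator (E - S) x \<partial>M)"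
      by (rule nn_integral_add[symmetric]) measurable
    also have "\<dots> = (\<integral>\<^sup>+x\<in>E. (if x \<in> S then h x else c) \<partial>M)"
      by (rule nn_integral_cong) (simp add: indicator_def)
    finally show "emeasure N E = (\<integral>\<^sup>+x\<in>E. (if x \<in> S then h x else c) \<partial>M)" .
  qed
  then show ?thesis
    by blast
qed

text \<open>Uniqueness on sets of finite measure spreads over \<open>S\<close> by
  \<open>AE_semifiniteI\<close>. For a semifinite part \<open>S\<close> nothing similar holds on the
  complement: \<open>M\<close> has only the values 0 and \<infinity> there, so all positive
  constants define the same measure.\<close>

lemma is_density_unique:
  assumes "semifinite (restrict_space M S)" "S \<in> sets M" "is_density M N h" "is_density M N h'"
  shows "AE x in M. x \<in> S \<longrightarrow> h x = h' x"
proof (rule AE_semifiniteI[OF assms(1,2)])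
  have [measurable]: "h \<in> borel_measurable M" "h' \<in> borel_measurable M" "S \<in> sets M"
    using assms by (auto simp: is_density_def)
  show "{x \<in> space M. x \<in> S \<and> h x \<noteq> h' x} \<in> sets M"
    by measurable
  fix F assume "F \<in> sets M" "emeasure M F < \<infinity>"
  then show "AE x in M. x \<in> F \<longrightarrow> h x = h' x"
  proof (rule density_unique_on_finite)
    fix E assume "E \<in> sets M"
    then show "(\<integral>\<^sup>+x\<in>E. h x \<partial>M) = (\<integral>\<^sup>+x\<in>E. h' x \<partial>M)"
      using assms(3,4) by (metis is_density_def)
  qed measurable
qed

text \<open>The zero set of any density is \<open>N\<close>-null. If it is also
  \<open>M\<close>-null, the density may be given the arbitrary positive value 1 there. Conversely,
  a strictly positive function has integral 0 only over null sets.\<close>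

lemma absolutely_continuous_iff_positive_density:
  assumes "sets N = sets M" and h: "is_density M N h"
  shows "absolutely_continuous N M \<longleftrightarrow> (\<exists>h. is_density M N h \<and> (\<forall>x\<in>space M. 0 < h x))"
proof
  have [measurable]: "h \<in> borel_measurable M"
    using h by (simp add: is_density_def)
  assume ac: "absolutely_continuous N M"
  let ?Z = "{x \<in> space M. h x = 0}"
  have Z: "?Z \<in> sets M"
    by measurable
  have "emeasure N ?Z = (\<integral>\<^sup>+x\<in>?Z. h x \<partial>M)"
    using h Z by (simp add: is_density_def)
  also have "\<dots> = (\<integral>\<^sup>+x. 0 \<partial>M)"
    by (rule nn_integral_cong) (simp add: indicator_def)
  finally have "emeasure M ?Z = 0"
    using Z assms(1) by (intro absolutely_continuousD[OF ac]) simp_all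
  then have "AE x in M. x \<notin> ?Z"
    using Z by (intro AE_not_in) (simp add: null_sets_def)
  then have "AE x in M. h x = (if h x = 0 then 1 else h x)"
    using AE_space by eventually_elim auto
  then have "is_density M N (\<lambda>x. if h x = 0 then 1 else h x)"
    by (rule is_density_cong_AE[OF h, rotated]) measurable
  then show "\<exists>h. is_density M N h \<and> (\<forall>x\<in>space M. 0 < h x)"
    by (intro exI[of _ "\<lambda>x. if h x = 0 then 1 else h x"]) (simp add: zero_less_iff_neq_zero)
next
  assume "\<exists>h. is_density M N h \<and> (\<forall>x\<in>space M. 0 < h x)"
  then obtain k where k: "is_density M N k" "\<forall>x\<in>space M. 0 < k x"
    by blast
  then have [measurable]: "k \<in> borel_measurable M"
    by (simp add: is_density_def)
  show "absolutely_continuous N M"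
    unfolding absolutely_continuous_def
  proof
    fix E assume "E \<in> null_sets N"
    then have E [measurable]: "E \<in> sets M" and "emeasure N E = 0"
      using assms(1) by auto
    then have "(\<integral>\<^sup>+x\<in>E. k x \<partial>M) = 0"
      using k(1) by (simp add: is_density_def)
    then have "AE x in M. k x * indicator E x = 0"
      by (subst (asm) nn_integral_0_iff_AE) measurable
    then have "AE x in M. x \<notin> E"
      using AE_space by eventually_elim (use k(2) in \<open>auto simp: indicator_def split: if_splits\<close>)
    then show "E \<in> null_sets M"
      using E by (simp add: AE_iff_null_sets)
  qed
qed

text \<open>Where a density is infinite, the measure takes only the values \<open>0\<close> and \<open>\<infinity>\<close>.\<close>

lemma semifinite_iff_finite_density:
  assumes "sets N = sets M" "S \<in> sets M"
    and semi: "semifinite_wrt (restrict_space M S) (restrict_space N S)"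
    and h: "is_density M N h"
  shows "semifinite (restrict_space N S) \<longleftrightarrow> (\<exists>h. is_density M N h \<and> (\<forall>x\<in>S. h x < \<infinity>))"
proof
  have [measurable]: "h \<in> borel_measurable M" "S \<in> sets M"
    using h assms by (auto simp: is_density_def)
  assume sfin: "semifinite (restrict_space N S)"
  let ?Z = "{x \<in> space M. x \<in> S \<and> h x = \<infinity>}"
  have Z: "?Z \<in> sets M"
    by measurable
  have top: "emeasure N F = \<infinity> * emeasure M F" if F: "F \<in> sets M" "F \<subseteq> ?Z" for F
  proof -
    have "emeasure N F = (\<integral>\<^sup>+x\<in>F. h x \<partial>M)"
      using h F(1) by (simp add: is_density_def)
    also have "\<dots> = (\<integral>\<^sup>+x. \<infinity> * indicator F x \<partial>M)"
      by (rule nn_integral_cong) (use F(2) in \<open>auto simp: indicator_def\<close>)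
    also have "\<dots> = \<infinity> * emeasure M F"
      using F(1) by (rule nn_integral_cmult_indicator)
    finally show ?thesis .
  qed
  have "emeasure M ?Z = 0"
  proof (rule ccontr)
    assume "emeasure M ?Z \<noteq> 0"
    then have pos: "0 < emeasure N ?Z"
      using top[OF Z] by (simp add: ennreal_top_mult)
    have "S \<in> sets N" "?Z \<in> sets N" "?Z \<subseteq> S"
      using assms(1,2) Z by auto
    from semifinite_restrict_spaceD[OF sfin this pos] obtain F
      where "F \<in> sets N" "F \<subseteq> ?Z" "0 < emeasure N F" "emeasure N F < \<infinity>"
      by blast
    with top[of F] assms(1) show False
      by (simp add: ennreal_top_mult split: if_splits)
  qed
  then have "AE x in M. x \<notin> ?Z"
    using Z by (intro AE_not_in) (simp add: null_sets_def)
  then have "AE x in M. h x = (if x \<in> S \<and> h x = \<infinity> then 0 else h x)"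
    using AE_space by eventually_elim auto
  then have "is_density M N (\<lambda>x. if x \<in> S \<and> h x = \<infinity> then 0 else h x)"
    by (rule is_density_cong_AE[OF h, rotated]) measurable
  then show "\<exists>h. is_density M N h \<and> (\<forall>x\<in>S. h x < \<infinity>)"
    by (intro exI[of _ "\<lambda>x. if x \<in> S \<and> h x = \<infinity> then 0 else h x"]) (simp add: less_top)
next
  assume "\<exists>h. is_density M N h \<and> (\<forall>x\<in>S. h x < \<infinity>)"
  then obtain k where k: "is_density M N k" "\<forall>x\<in>S. k x < \<infinity>"
    by blast
  then have [measurable]: "k \<in> borel_measurable M"
    by (simp add: is_density_def)
  show "semifinite (restrict_space N S)"
  proof (rule semifinite_restrict_spaceI)
    fix E assume E: "E \<in> sets N" "E \<subseteq> S" "emeasure N E = \<infinity>"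
    then have "E \<in> sets M" "0 < emeasure N E"
      using assms(1) by simp_all
    then obtain F where F: "F \<in> sets M" "F \<subseteq> E" "emeasure M F < \<infinity>" "0 < emeasure N F"
      using semi E(2) unfolding semifinite_wrt_restrict_space_iff[OF assms(2,1)] by blast
    note [measurable] = F(1)
    \<comment> \<open>Finiteness of \<open>k\<close> makes these level sets cover \<open>F\<close>,
      so one of them has positive \<open>N\<close>-measure; there \<open>k\<close> is at most
      \<open>n\<close>, and \<open>N\<close> is bounded by \<open>n\<close> times the finite
      \<open>M\<close>-measure of \<open>F\<close>.\<close>
    define B where "B n = {x \<in> space M. x \<in> F \<and> k x \<le> of_nat n}" for n
    have B: "B n \<in> sets M" for n
      unfolding B_def by measurable
    have "F \<subseteq> (\<Union>n. B n)"
    proof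
      fix x assume x: "x \<in> F"
      then have "k x < \<infinity>"
        using k(2) F(2) E(2) by blast
      then obtain n where "k x \<le> of_nat n"
        using ennreal_Ex_less_of_nat[of "k x"] by (auto intro: less_imp_le)
      then show "x \<in> (\<Union>n. B n)"
        using x sets.sets_into_space[OF F(1)] by (auto simp: B_def)
    qed
    have "\<exists>n. emeasure N (B n) \<noteq> 0"
    proof (rule ccontr)
      assume "\<nexists>n. emeasure N (B n) \<noteq> 0"
      then have "(\<Union>n. B n) \<in> null_sets N"
        using B assms(1) by (intro null_sets_UN) (simp add: null_sets_def)
      then have "emeasure N F \<le> 0"
        using emeasure_mono[OF \<open>F \<subseteq> (\<Union>n. B n)\<close>, of N] by (simp add: null_sets_def)
      with F(4) show False
        by simp
    qed
    then obtain n where n: "emeasure N (B n) \<noteq> 0"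
      by blast
    have "emeasure N (B n) = (\<integral>\<^sup>+x\<in>B n. k x \<partial>M)"
      using k(1) B by (simp add: is_density_def)
    also have "\<dots> \<le> (\<integral>\<^sup>+x. of_nat n * indicator F x \<partial>M)"
      by (rule nn_integral_mono) (simp add: indicator_def B_def)
    also have "\<dots> = of_nat n * emeasure M F"
      using F(1) by (rule nn_integral_cmult_indicator)
    also have "\<dots> < \<infinity>"
      using F(3) by (simp add: ennreal_mult_less_top of_nat_less_top)
    finally have "emeasure N (B n) < \<infinity>" .
    moreover have "B n \<subseteq> E"
      using F(2) by (auto simp: B_def)
    ultimately show "\<exists>F\<in>sets N. F \<subseteq> E \<and> 0 < emeasure N F \<and> emeasure N F < \<infinity>"
      using n B[of n] assms(1) by (intro bexI[of _ "B n"]) (simp_all add: zero_less_iff_neq_zero)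
  qed (use assms(1,2) in simp)
qed

theorem theorem4p7:
  fixes \<mu> \<nu> :: "'a measure" and S :: "'a set"
  assumes "Dedekind \<mu>"
    and "sets \<nu> = sets \<mu>"
    and "absolutely_continuous \<mu> \<nu>"
    and "semifinite_part \<mu> S"
    and "semifinite_wrt \<mu> \<nu> \<or>
         (semifinite_wrt (restrict_space \<mu> S) (restrict_space \<nu> S) \<and> infinite_off \<mu> \<nu> S)"
  shows "(\<exists>h. is_density \<mu> \<nu> h) \<and>
         (\<forall>h h'. is_density \<mu> \<nu> h \<and> is_density \<mu> \<nu> h' \<longrightarrow> (AE x in \<mu>. x \<in> S \<longrightarrow> h x = h' x)) \<and>
         normal_functional TYPE('i) \<mu> (integral_functional \<nu>) \<and>
         (absolutely_continuous \<nu> \<mu> \<longleftrightarrow>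
            (\<exists>h. is_density \<mu> \<nu> h \<and> (\<forall>x\<in>space \<mu>. 0 < h x))) \<and>
         (semifinite (restrict_space \<nu> S) \<longleftrightarrow>
            (\<exists>h. is_density \<mu> \<nu> h \<and> (\<forall>x\<in>S. h x < \<infinity>)))"
proof -
  note cases = semifinite_part_cases[OF assms(2-5)]
  have S: "S \<in> sets \<mu>" "semifinite (restrict_space \<mu> S)"
    using assms(4) by (simp_all add: semifinite_part_def)
  obtain h where h: "is_density \<mu> \<nu> h"
    using is_density_exists[OF assms(1-4) cases] by blast
  have "AE x in \<mu>. x \<in> S \<longrightarrow> k x = k' x" if "is_density \<mu> \<nu> k" "is_density \<mu> \<nu> k'" for k k'
    by (rule is_density_unique[OF S(2,1) that])
  moreover have "normal_functional TYPE('i) \<mu> (integral_functional \<nu>)"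
    by (rule normal_integral_functional[OF assms(2,3) S(1)
          semifinite_wrt_density_indicator[OF S(1) assms(2) cases(1)] cases(2)])
  ultimately show ?thesis
    using h absolutely_continuous_iff_positive_density[OF assms(2) h]
      semifinite_iff_finite_density[OF assms(2) S(1) cases(1) h] by blast
qed

end
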